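(* Let $(\Gamma,\mathcal G)$ be a boundary pair associated with the quadratic form $\mathfrak h$ and let $z\in\mathbb C\setminus(\sigma(H^D)\cup\sigma(H))$. (i) The following weak versions of Krein's resolvent identity hold: $$\breve R(z)-\iota\breve R^D(z)\iota^*=P(z)\breve R(z)=S(z)\,\breve\Lambda(z)^{-1}\,S(\overline z)^*$$ as operators $\mathcal H^{-1}\xrightarrow{S(\overline z)^*}\mathcal G^{-1/2}\xrightarrow{\breve\Lambda(z)^{-1}}\mathcal G^{1/2}\xrightarrow{S(z)}\mathcal H^1$, and $$R(z)-R^D(z)=S(z)\,\breve\Lambda(z)^{-1}\,S(\overline z)^*$$ as operators $\mathcal H\xrightarrow{S(\overline z)^*}\mathcal G^{-1/2}\xrightarrow{\breve\Lambda(z)^{-1}}\mathcal G^{1/2}\xrightarrow{S(z)}\mathcal H$. (ii) If, in addition, the boundary pair is elliptically regular, then $$R(z)-R^D(z)=\overline S(z)\,\Lambda(z)^{-1}\,\overline S(\overline z)^*\colon\ \mathcal H\xrightarrow{\overline S(\overline z)^*}\mathcal G\xrightarrow{\Lambda(z)^{-1}}\mathcal G\xrightarrow{\overline S(z)}\mathcal H .$$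
   Context: All Hilbert spaces are complex; inner products and sesquilinear forms are linear in the first argument. Let $\mathfrak h$ be a closed, non-negative, densely defined quadratic form in a Hilbert space $\mathcal H$ (the same symbol denotes its sesquilinear form), with domain $\mathcal H^1:=\operatorname{dom}\mathfrak h$, a Hilbert space with norm $\|u\|_{\mathcal H^1}^2=\mathfrak h(u)+\|u\|_{\mathcal H}^2$. A boundary pair associated with $\mathfrak h$ is a pair $(\Gamma,\mathcal G)$ of a Hilbert space $\mathcal G$ and a bounded operator $\Gamma\colon\mathcal H^1\to\mathcal G$ such that $\mathcal H^{1,D}:=\ker\Gamma$ is dense in $\mathcal H$ and $\mathcal G^{1/2}:=\operatorname{ran}\Gamma$ is dense in $\mathcal G$. The Neumann operator $H$ is the self-adjoint operator associated with $\mathfrak h$; the Dirichlet operator $H^D$ is the self-adjoint operator associated with the closed form $\mathfrak h|_{\mathcal H^{1,D}}$; $R(z):=(H-z)^{-1}$, $R^D(z):=(H^D-z)^{-1}$. For $z\in\mathbb C$ let $\mathcal N^1(z):=\{h\in\mathcal H^1: \mathfrak h(h,f)=z\langle h,f\rangle_{\mathcal H}\ \forall f\in\mathcal H^{1,D}\}$. For $z\notin\sigma(H^D)$, $\mathcal H^1$ is the direct topological sum of $\mathcal H^{1,D}$ and $\mathcal N^1(z)$; $P(z)$ is the projection in $\mathcal H^1$ onto $\mathcal N^1(z)$ along $\mathcal H^{1,D}$. $\Gamma$ restricts to a bijection $\mathcal N^1(z)\to\mathcal G^{1/2}$, whose inverse is $S(z)\colon\mathcal G^{1/2}\to\mathcal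 N^1(z)\subset\mathcal H^1$ (so $P(z)=S(z)\Gamma$). The space $\mathcal G^{1/2}$ is a Hilbert space with norm $\|\phi\|_{\mathcal G^{1/2}}:=\|S(-1)\phi\|_{\mathcal H^1}$. $\mathcal H^{-1}$, $\mathcal H^{-1,D}$, $\mathcal G^{-1/2}$ denote the duals of $\mathcal H^1$, $\mathcal H^{1,D}$, $\mathcal G^{1/2}$ with respect to the (sesquilinear) pairings extending the inner products of $\mathcal H$, $\mathcal H$, $\mathcal G$ respectively, so that $\mathcal H^1\subset\mathcal H\subset\mathcal H^{-1}$ etc. $\breve H\colon\mathcal H^1\to\mathcal H^{-1}$ is defined by $\langle\breve Hu,v\rangle=\mathfrak h(u,v)$ and $\breve R(z):=(\breve H-z)^{-1}\colon\mathcal H^{-1}\to\mathcal H^1$; analogously $\breve R^D(z):=(\breve H^D-z)^{-1}\colon\mathcal H^{-1,D}\to\mathcal H^{1,D}$ for $\mathfrak h|_{\mathcal H^{1,D}}$. $\iota\colon\mathcal H^{1,D}\to\mathcal H^1$ is the inclusion and $\iota^*\colon\mathcal H^{-1}\to\mathcal H^{-1,D}$ its dual; $S(\overline z)^*\colon\mathcal H^{-1}\to\mathcal G^{-1/2}$ is the dual of $S(\overline z)$. The Dirichlet-to-Neumann form is $\mathfrak l_z(\phi,\psi):=\mathfrak h(S(z)\phi,S(-1)\psi)-z\langle S(z)\phi,S(-1)\psi\rangle_{\mathcal H}$ on $\mathcal G^{1/2}$. The weak Dirichlet-to-Neumann operator $\breve\Lambda(z)\colon\mathcal G^{1/2}\to\mathcal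 G^{-1/2}$ is defined by $\langle\breve\Lambda(z)\phi,\psi\rangle=\mathfrak l_z(\phi,\psi)$; it is bijective for $z\notin\sigma(H)\cup\sigma(H^D)$. The strong operator $\Lambda(z)$ is the restriction of $\breve\Lambda(z)$ to $\{\phi\in\mathcal G^{1/2}:\breve\Lambda(z)\phi\in\mathcal G\}$, as an operator in $\mathcal G$; $\Lambda(z)^{-1}\colon\mathcal G\to\mathcal G$ is its inverse. The boundary pair is elliptically regular if there is $C>0$ with $\|S(-1)\phi\|_{\mathcal H}\le C\|\phi\|_{\mathcal G}$ for all $\phi\in\mathcal G^{1/2}$; then every $S(z)$ extends to a bounded operator $\overline S(z)\colon\mathcal G\to\mathcal H$, and $\overline S(\overline z)^*\colon\mathcal H\to\mathcal G$ is the Hilbert space adjoint. *)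

theory Defs
  imports "HOL-Analysis.Analysis"
begin

section \<open>Complex Hilbert spaces\<close>

text \<open>
  The real structure (norm, topology, \<open>inner\<close>) is inherited from \<open>real_inner\<close>;
  the inner product \<open>cinner\<close> is linear in its first argument.
\<close>

class chilbert_space = real_inner + complete_space +
  fixes scaleC :: "complex \<Rightarrow> 'a \<Rightarrow> 'a" (infixr \<open>*\<^sub>C\<close> 75)
    and cinner :: "'a \<Rightarrow> 'a \<Rightarrow> complex"
  assumes scaleC_add_right: "a *\<^sub>C (x + y) = a *\<^sub>C x + a *\<^sub>C y"
    and scaleC_add_left: "(a + b) *\<^sub>C x = a *\<^sub>C x + b *\<^sub>C x"
    and scaleC_scaleC: "a *\<^sub>C b *\<^sub>C x = (a * b) *\<^sub>C x"
    and scaleC_of_real: "complex_of_real r *\<^sub>C x = r *\<^sub>R x"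
    and cinner_commute: "cinner x y = cnj (cinner y x)"
    and cinner_add_left: "cinner (x + y) w = cinner x w + cinner y w"
    and cinner_scaleC_left: "cinner (a *\<^sub>C x) y = a * cinner x y"
    and Re_cinner: "Re (cinner x y) = inner x y"

instantiation complex :: chilbert_space
begin
definition "scaleC_complex (a :: complex) (x :: complex) = a * x"
definition "cinner_complex (x :: complex) (y :: complex) = x * cnj y"
instance
  by standard
    (auto simp: scaleC_complex_def cinner_complex_def inner_complex_def
      algebra_simps scaleR_conv_of_real)
end

definition csubspace :: "'a::chilbert_space set \<Rightarrow> bool" where
  "csubspace V \<longleftrightarrow> 0 \<in> V \<and> (\<forall>u\<in>V. \<forall>v\<in>V. u + v \<in> V) \<and> (\<forall>c. \<forall>u\<in>V. c *\<^sub>C u \<in> V)"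

definition clinear_on :: "'a::chilbert_space set \<Rightarrow> ('a \<Rightarrow> 'b::chilbert_space) \<Rightarrow> bool" where
  "clinear_on V T \<longleftrightarrow>
     (\<forall>u\<in>V. \<forall>v\<in>V. T (u + v) = T u + T v) \<and> (\<forall>c. \<forall>u\<in>V. T (c *\<^sub>C u) = c *\<^sub>C T u)"

definition bounded_clinear :: "('a::chilbert_space \<Rightarrow> 'b::chilbert_space) \<Rightarrow> bool" where
  "bounded_clinear T \<longleftrightarrow> clinear_on UNIV T \<and> (\<exists>C. \<forall>x. norm (T x) \<le> C * norm x)"

definition cadjoint :: "('a::chilbert_space \<Rightarrow> 'b::chilbert_space) \<Rightarrow> 'b \<Rightarrow> 'a" where
  "cadjoint T = (THE T'. \<forall>x y. cinner (T x) y = cinner x (T' y))"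


section \<open>Unbounded operators\<close>

text \<open>An operator in a Hilbert space is represented by its graph.\<close>

definition op_shift :: "('a::chilbert_space \<times> 'a) set \<Rightarrow> complex \<Rightarrow> ('a \<times> 'a) set" where
  "op_shift A z = {(u, w - z *\<^sub>C u) | u w. (u, w) \<in> A}"

definition op_inv :: "('a \<times> 'b) set \<Rightarrow> 'b \<Rightarrow> 'a" where
  "op_inv A w = (THE u. (u, w) \<in> A)"

definition resolvent_set :: "('a::chilbert_space \<times> 'a) set \<Rightarrow> complex set" where
  "resolvent_set A =
     {z. (\<forall>f. \<exists>!u. (u, f) \<in> op_shift A z) \<and>
         (\<exists>C. \<forall>(u, f) \<in> op_shift A z. norm u \<le> C * norm f)}"

definition spectrum :: "('a::chilbert_space \<times> 'a) set \<Rightarrow> complex set" where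
  "spectrum A = - resolvent_set A"

definition resolvent :: "('a::chilbert_space \<times> 'a) set \<Rightarrow> complex \<Rightarrow> 'a \<Rightarrow> 'a" where
  "resolvent A z = op_inv (op_shift A z)"


section \<open>Closed non-negative forms\<close>

text \<open>
  A form is given by its domain \<open>D\<close> and its sesquilinear form \<open>h\<close>; only the values
  of \<open>h\<close> on \<open>D \<times> D\<close> matter, and the quadratic form is \<open>\<lambda>u. h u u\<close>.
\<close>

definition sesquilinear_on ::
    "'a::chilbert_space set \<Rightarrow> ('a \<Rightarrow> 'a \<Rightarrow> complex) \<Rightarrow> bool" where
  "sesquilinear_on D h \<longleftrightarrow>
     (\<forall>u\<in>D. \<forall>v\<in>D. \<forall>w\<in>D. h (u + v) w = h u w + h v w \<and> h w (u + v) = h w u + h w v) \<and>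
     (\<forall>c. \<forall>u\<in>D. \<forall>v\<in>D. h (c *\<^sub>C u) v = c * h u v \<and> h u (c *\<^sub>C v) = cnj c * h u v)"

definition form_norm :: "('a::chilbert_space \<Rightarrow> 'a \<Rightarrow> complex) \<Rightarrow> 'a \<Rightarrow> real" where
  "form_norm h u = sqrt (Re (h u u) + (norm u)\<^sup>2)"

definition closed_nonneg_form ::
    "'a::chilbert_space set \<Rightarrow> ('a \<Rightarrow> 'a \<Rightarrow> complex) \<Rightarrow> bool" where
  "closed_nonneg_form D h \<longleftrightarrow>
     csubspace D \<and> closure D = UNIV \<and> sesquilinear_on D h \<and>
     (\<forall>u\<in>D. h u u \<in> \<real> \<and> 0 \<le> Re (h u u)) \<and>
     (\<forall>X. (\<forall>n. X n \<in> D) \<and>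
          (\<forall>e>0. \<exists>M::nat. \<forall>m\<ge>M. \<forall>n\<ge>M. form_norm h (X m - X n) < e) \<longrightarrow>
          (\<exists>u\<in>D. (\<lambda>n. form_norm h (X n - u)) \<longlonglongrightarrow> 0))"

text \<open>The operator associated with a form: \<open>h(u, v) = \<langle>A u, v\<rangle>\<close> for all \<open>v\<close> in the form domain.\<close>

definition form_op ::
    "'a::chilbert_space set \<Rightarrow> ('a \<Rightarrow> 'a \<Rightarrow> complex) \<Rightarrow> ('a \<times> 'a) set" where
  "form_op D h = {(u, w). u \<in> D \<and> (\<forall>v\<in>D. h u v = cinner w v)}"


section \<open>Duals with respect to the sesquilinear pairing\<close>

text \<open>
  An element \<open>F\<close> of the dual of \<open>V\<close> (a subspace carrying its own norm \<open>nrm\<close>) is represented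
  by the antilinear functional \<open>v \<mapsto> \<langle>F, v\<rangle>\<close>, extensional on \<open>V\<close>, so that equality of
  functions is equality in the dual.  The ambient Hilbert space embeds by \<open>to_dual\<close>.
\<close>

definition antidual ::
    "'a::chilbert_space set \<Rightarrow> ('a \<Rightarrow> real) \<Rightarrow> ('a \<Rightarrow> complex) set" where
  "antidual V nrm =
     {F \<in> extensional V.
        (\<forall>u\<in>V. \<forall>v\<in>V. F (u + v) = F u + F v) \<and>
        (\<forall>c. \<forall>u\<in>V. F (c *\<^sub>C u) = cnj c * F u) \<and>
        (\<exists>C. \<forall>u\<in>V. cmod (F u) \<le> C * nrm u)}"

definition to_dual :: "'a::chilbert_space set \<Rightarrow> 'a \<Rightarrow> 'a \<Rightarrow> complex" where
  "to_dual V f = (\<lambda>v\<in>V. cinner f v)"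

text \<open>The dual of \<open>T : V \<rightarrow> W\<close>, i.e. \<open>\<langle>T\<^sup>* F, v\<rangle> = \<langle>F, T v\<rangle>\<close> for \<open>v\<close> in \<open>V\<close>.\<close>

definition dual_map :: "'b set \<Rightarrow> ('b \<Rightarrow> 'a) \<Rightarrow> ('a \<Rightarrow> complex) \<Rightarrow> 'b \<Rightarrow> complex" where
  "dual_map V T F = (\<lambda>v\<in>V. F (T v))"

definition weak_op ::
    "'a::chilbert_space set \<Rightarrow> ('a \<Rightarrow> 'a \<Rightarrow> complex) \<Rightarrow> 'a \<Rightarrow> 'a \<Rightarrow> complex" where
  "weak_op V h u = (\<lambda>v\<in>V. h u v)"

definition weak_resolvent ::
    "'a::chilbert_space set \<Rightarrow> ('a \<Rightarrow> 'a \<Rightarrow> complex) \<Rightarrow> complex \<Rightarrow> ('a \<Rightarrow> complex) \<Rightarrow> 'a" where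
  "weak_resolvent V h z =
     the_inv_into V (\<lambda>u. \<lambda>v\<in>V. weak_op V h u v - z * to_dual V u v)"


section \<open>Boundary pairs\<close>

text \<open>
  In the usual notation, with \<open>\<H>\<^sup>1 = D\<close>: \<open>dirichlet_dom\<close> is \<open>\<H>\<^sup>1\<^sup>,\<^sup>D = ker \<Gamma>\<close>, \<open>\<Gamma> ` D\<close> is
  \<open>\<G>\<^sup>1\<^sup>/\<^sup>2\<close> with norm \<open>bd_norm\<close>, \<open>weak_solutions\<close> is \<open>\<N>\<^sup>1(z)\<close>, \<open>solution_proj\<close> is \<open>P(z)\<close> (the
  projection onto \<open>\<N>\<^sup>1(z)\<close> along \<open>\<H>\<^sup>1\<^sup>,\<^sup>D\<close>), \<open>solution_op\<close> is \<open>S(z)\<close>; \<open>weak_DN\<close> and \<open>strong_DN\<close>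
  are the weak and the strong Dirichlet-to-Neumann operator.
\<close>

definition dirichlet_dom ::
    "'a::chilbert_space set \<Rightarrow> ('a \<Rightarrow> 'b::chilbert_space) \<Rightarrow> 'a set" where
  "dirichlet_dom D \<Gamma> = {u \<in> D. \<Gamma> u = 0}"

definition boundary_pair ::
    "'a::chilbert_space set \<Rightarrow> ('a \<Rightarrow> 'a \<Rightarrow> complex) \<Rightarrow> ('a \<Rightarrow> 'b::chilbert_space) \<Rightarrow> bool" where
  "boundary_pair D h \<Gamma> \<longleftrightarrow>
     clinear_on D \<Gamma> \<and> (\<exists>C. \<forall>u\<in>D. norm (\<Gamma> u) \<le> C * form_norm h u) \<and>
     closure (dirichlet_dom D \<Gamma>) = UNIV \<and> closure (\<Gamma> ` D) = UNIV"

definition weak_solutions ::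
    "'a::chilbert_space set \<Rightarrow> ('a \<Rightarrow> 'a \<Rightarrow> complex) \<Rightarrow> ('a \<Rightarrow> 'b::chilbert_space)
      \<Rightarrow> complex \<Rightarrow> 'a set" where
  "weak_solutions D h \<Gamma> z = {u \<in> D. \<forall>f \<in> dirichlet_dom D \<Gamma>. h u f = z * cinner u f}"

definition solution_proj ::
    "'a::chilbert_space set \<Rightarrow> ('a \<Rightarrow> 'a \<Rightarrow> complex) \<Rightarrow> ('a \<Rightarrow> 'b::chilbert_space)
      \<Rightarrow> complex \<Rightarrow> 'a \<Rightarrow> 'a" where
  "solution_proj D h \<Gamma> z u =
     (THE p. p \<in> weak_solutions D h \<Gamma> z \<and> u - p \<in> dirichlet_dom D \<Gamma>)"

definition solution_op ::
    "'a::chilbert_space set \<Rightarrow> ('a \<Rightarrow> 'a \<Rightarrow> complex) \<Rightarrow> ('a \<Rightarrow> 'b::chilbert_space)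
      \<Rightarrow> complex \<Rightarrow> 'b \<Rightarrow> 'a" where
  "solution_op D h \<Gamma> z = the_inv_into (weak_solutions D h \<Gamma> z) \<Gamma>"

definition bd_norm ::
    "'a::chilbert_space set \<Rightarrow> ('a \<Rightarrow> 'a \<Rightarrow> complex) \<Rightarrow> ('a \<Rightarrow> 'b::chilbert_space)
      \<Rightarrow> 'b \<Rightarrow> real" where
  "bd_norm D h \<Gamma> \<phi> = form_norm h (solution_op D h \<Gamma> (-1) \<phi>)"

definition DN_form ::
    "'a::chilbert_space set \<Rightarrow> ('a \<Rightarrow> 'a \<Rightarrow> complex) \<Rightarrow> ('a \<Rightarrow> 'b::chilbert_space)
      \<Rightarrow> complex \<Rightarrow> 'b \<Rightarrow> 'b \<Rightarrow> complex" where
  "DN_form D h \<Gamma> z \<phi> \<psi> =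
     h (solution_op D h \<Gamma> z \<phi>) (solution_op D h \<Gamma> (-1) \<psi>) -
     z * cinner (solution_op D h \<Gamma> z \<phi>) (solution_op D h \<Gamma> (-1) \<psi>)"

definition weak_DN ::
    "'a::chilbert_space set \<Rightarrow> ('a \<Rightarrow> 'a \<Rightarrow> complex) \<Rightarrow> ('a \<Rightarrow> 'b::chilbert_space)
      \<Rightarrow> complex \<Rightarrow> 'b \<Rightarrow> 'b \<Rightarrow> complex" where
  "weak_DN D h \<Gamma> z \<phi> = (\<lambda>\<psi> \<in> \<Gamma> ` D. DN_form D h \<Gamma> z \<phi> \<psi>)"

definition weak_DN_inv ::
    "'a::chilbert_space set \<Rightarrow> ('a \<Rightarrow> 'a \<Rightarrow> complex) \<Rightarrow> ('a \<Rightarrow> 'b::chilbert_space)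
      \<Rightarrow> complex \<Rightarrow> ('b \<Rightarrow> complex) \<Rightarrow> 'b" where
  "weak_DN_inv D h \<Gamma> z = the_inv_into (\<Gamma> ` D) (weak_DN D h \<Gamma> z)"

definition strong_DN ::
    "'a::chilbert_space set \<Rightarrow> ('a \<Rightarrow> 'a \<Rightarrow> complex) \<Rightarrow> ('a \<Rightarrow> 'b::chilbert_space)
      \<Rightarrow> complex \<Rightarrow> ('b \<times> 'b) set" where
  "strong_DN D h \<Gamma> z = {(\<phi>, g). \<phi> \<in> \<Gamma> ` D \<and> weak_DN D h \<Gamma> z \<phi> = to_dual (\<Gamma> ` D) g}"

definition elliptically_regular ::
    "'a::chilbert_space set \<Rightarrow> ('a \<Rightarrow> 'a \<Rightarrow> complex) \<Rightarrow> ('a \<Rightarrow> 'b::chilbert_space) \<Rightarrow> bool" where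
  "elliptically_regular D h \<Gamma> \<longleftrightarrow>
     (\<exists>C>0. \<forall>\<phi> \<in> \<Gamma> ` D. norm (solution_op D h \<Gamma> (-1) \<phi>) \<le> C * norm \<phi>)"

text \<open>
  The bounded extension of \<open>S(z)\<close> to the whole boundary space; it is unique because
  \<open>\<Gamma> ` D\<close> is dense, and it exists if the boundary pair is elliptically regular.
\<close>

definition solution_op_ext ::
    "'a::chilbert_space set \<Rightarrow> ('a \<Rightarrow> 'a \<Rightarrow> complex) \<Rightarrow> ('a \<Rightarrow> 'b::chilbert_space)
      \<Rightarrow> complex \<Rightarrow> 'b \<Rightarrow> 'a" where
  "solution_op_ext D h \<Gamma> z =
     (THE T. bounded_clinear T \<and> (\<forall>\<phi> \<in> \<Gamma> ` D. T \<phi> = solution_op D h \<Gamma> z \<phi>))"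

end

theory Submission
  imports Defs
begin

text \<open>
  Everything is phrased through the shifted form \<open>h(u, v) - z \<langle>u, v\<rangle>\<close>. The Riesz theorem for the form
  norm solves the weak equation at \<open>-1\<close>, and for \<open>z\<close> in the resolvent set the strong resolvent
  corrects this solution to one at \<open>z\<close>. If \<open>u\<close> and \<open>d\<close> are the Neumann and Dirichlet solutions with
  right-hand side \<open>F\<close>, then \<open>u - d\<close> is annihilated by Dirichlet test functions and has the trace of
  \<open>u\<close>, so \<open>u - d = P(z) u = S(z) \<Gamma> u\<close>. Testing \<open>u - d\<close> with \<open>S(cnj z) \<psi>\<close>, which pairs to zero with
  \<open>d\<close>, identifies the Dirichlet-to-Neumann image of \<open>\<Gamma> u\<close> as the functional \<open>\<psi> \<mapsto> F(S(cnj z) \<psi>)\<close>.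
  The bounds on \<open>S(z)\<close> come from \<open>S(z) = S(-1) + (z + 1) R\<^sup>D(z) S(-1)\<close>.
\<close>

section \<open>Complex inner products\<close>

lemma scaleC_minus_one: "(-1) *\<^sub>C (x::'a::chilbert_space) = - x"
  using scaleC_of_real[of "-1" x] by simp

lemma scaleC_zero_left [simp]: "0 *\<^sub>C (x::'a::chilbert_space) = 0"
  using scaleC_of_real[of 0 x] by simp

lemma scaleC_zero_right [simp]: "c *\<^sub>C (0::'a::chilbert_space) = 0"
  using scaleC_add_right[of c "0::'a" 0] by simp

lemma scaleC_minus_right: "c *\<^sub>C (- x) = - (c *\<^sub>C (x::'a::chilbert_space))"
  by (metis mult.commute scaleC_minus_one scaleC_scaleC)

lemma scaleC_diff_right: "c *\<^sub>C (x - y) = c *\<^sub>C x - c *\<^sub>C (y::'a::chilbert_space)"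
  using scaleC_add_right[of c x "- y"] by (simp add: scaleC_minus_right)

lemma csubspace_UNIV [simp]: "csubspace UNIV"
  by (simp add: csubspace_def)

lemma csubspace_diff: "csubspace V \<Longrightarrow> u \<in> V \<Longrightarrow> v \<in> V \<Longrightarrow> u - v \<in> V"
  unfolding csubspace_def by (metis add_uminus_conv_diff scaleC_minus_one)

lemma clinear_on_diff:
  assumes "csubspace V" "clinear_on V T" "u \<in> V" "v \<in> V"
  shows "T (u - v) = T u - T v"
proof -
  have "T (u + (-1) *\<^sub>C v) = T u + (-1) *\<^sub>C T v"
    using assms unfolding clinear_on_def csubspace_def by simp
  then show ?thesis
    by (simp add: scaleC_minus_one)
qed

lemma sesquilinear_on_subset: "sesquilinear_on V b \<Longrightarrow> W \<subseteq> V \<Longrightarrow> sesquilinear_on W b"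
  unfolding sesquilinear_on_def by blast

section \<open>Sesquilinear and non-negative forms on a subspace\<close>

locale sesquilinear_form =
  fixes V :: "'a::chilbert_space set" and b :: "'a \<Rightarrow> 'a \<Rightarrow> complex"
  assumes subspace: "csubspace V" and sesquilinear: "sesquilinear_on V b"
begin

lemma zero_mem [simp]: "0 \<in> V"
  and add_mem [simp]: "u \<in> V \<Longrightarrow> v \<in> V \<Longrightarrow> u + v \<in> V"
  and scaleC_mem [simp]: "u \<in> V \<Longrightarrow> c *\<^sub>C u \<in> V"
  using subspace by (auto simp: csubspace_def)

lemma diff_mem [simp]: "u \<in> V \<Longrightarrow> v \<in> V \<Longrightarrow> u - v \<in> V"
  by (rule csubspace_diff[OF subspace])

lemma add_left: "u \<in> V \<Longrightarrow> v \<in> V \<Longrightarrow> w \<in> V \<Longrightarrow> b (u + v) w = b u w + b v w"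
  and add_right: "u \<in> V \<Longrightarrow> v \<in> V \<Longrightarrow> w \<in> V \<Longrightarrow> b w (u + v) = b w u + b w v"
  and scaleC_left: "u \<in> V \<Longrightarrow> v \<in> V \<Longrightarrow> b (c *\<^sub>C u) v = c * b u v"
  and scaleC_right: "u \<in> V \<Longrightarrow> v \<in> V \<Longrightarrow> b u (c *\<^sub>C v) = cnj c * b u v"
  using sesquilinear by (auto simp: sesquilinear_on_def)

lemma diff_left: "u \<in> V \<Longrightarrow> v \<in> V \<Longrightarrow> w \<in> V \<Longrightarrow> b (u - v) w = b u w - b v w"
  using add_left[of u "(-1) *\<^sub>C v" w] scaleC_left[of v w "-1"]
    scaleC_mem[of v "-1"]
  by (simp add: scaleC_minus_one)

lemma diff_right: "u \<in> V \<Longrightarrow> v \<in> V \<Longrightarrow> w \<in> V \<Longrightarrow> b w (u - v) = b w u - b w v"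
  using add_right[of u "(-1) *\<^sub>C v" w] scaleC_right[of w v "-1"] scaleC_mem[of v "-1"]
  by (simp add: scaleC_minus_one)

end

locale nonneg_form = sesquilinear_form +
  assumes nonneg: "u \<in> V \<Longrightarrow> b u u \<in> \<real> \<and> 0 \<le> Re (b u u)"
begin

lemma real_diag [simp]: "u \<in> V \<Longrightarrow> Im (b u u) = 0"
  using nonneg complex_is_Real_iff by blast

text \<open>A real diagonal forces symmetry: its values at \<open>u + v\<close> and at
  \<open>u + \<i> *\<^sub>C v\<close> settle the imaginary and the real parts respectively.\<close>

lemma hermitian:
  assumes "u \<in> V" "v \<in> V"
  shows "b u v = cnj (b v u)"
proof -
  have "Im (b (u + v) (u + v)) = 0"
    using assms by (intro real_diag) simp
  then have *: "Im (b u v) + Im (b v u) = 0"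
    using assms by (simp add: add_left add_right)
  have "Im (b (u + \<i> *\<^sub>C v) (u + \<i> *\<^sub>C v)) = 0"
    using assms by (intro real_diag) simp
  then have "Re (b v u) - Re (b u v) = 0"
    using assms by (simp add: add_left add_right scaleC_left scaleC_right)
  with * show ?thesis
    by (simp add: complex_eq_iff)
qed

text \<open>Non-negativity along the line \<open>u + c *\<^sub>C v\<close> with \<open>c\<close> a
  real multiple of \<open>b u v\<close> gives a real quadratic in that multiple. The form may be
  degenerate, so \<open>q = 0\<close> is a case of its own.\<close>

lemma cauchy_schwarz_sq:
  assumes uv: "u \<in> V" "v \<in> V"
  shows "(cmod (b u v))\<^sup>2 \<le> Re (b u u) * Re (b v v)"
proof -
  define p where "p = (cmod (b u v))\<^sup>2"
  define a where "a = Re (b u u)"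
  define q where "q = Re (b v v)"
  have bvv: "b v v = of_real q"
    using uv by (simp add: q_def complex_eq_iff)
  have *: "0 \<le> a + 2 * t * p + t\<^sup>2 * p * q" for t
  proof -
    define c where "c = of_real t * b u v"
    have "0 \<le> Re (b (u + c *\<^sub>C v) (u + c *\<^sub>C v))"
      using uv nonneg[of "u + c *\<^sub>C v"] by simp
    also have "b (u + c *\<^sub>C v) (u + c *\<^sub>C v) = b u u + cnj c * b u v + c * cnj (b u v) + c * cnj c * b v v"
      using uv by (simp add: add_left add_right scaleC_left scaleC_right algebra_simps hermitian[of v u])
    also have "\<dots> = b u u + 2 * of_real t * (b u v * cnj (b u v)) + (of_real t)\<^sup>2 * (b u v * cnj (b u v)) * b v v"
      by (simp add: c_def power2_eq_square algebra_simps)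
    also have "Re \<dots> = a + 2 * t * p + t\<^sup>2 * p * q"
      unfolding bvv complex_norm_square[symmetric] p_def[symmetric]
      by (simp add: a_def flip: of_real_power of_real_mult)
    finally show ?thesis .
  qed
  have "p \<le> a * q"
  proof (cases "q = 0")
    case True
    have "p = 0"
    proof (rule ccontr)
      assume "p \<noteq> 0"
      then show False
        \<comment> \<open>With \<open>q = 0\<close> the quadratic is affine, and at this point its
          value is -1.\<close>
        using *[of "- (a + 1) / (2 * p)"] *[of 0] True by (simp add: field_simps)
    qed
    then show ?thesis
      using True by simp
  next
    case False
    moreover have "0 \<le> q"
      using nonneg uv by (simp add: q_def)
    ultimately show ?thesis
      \<comment> \<open>This is the minimiser of the quadratic, where its value is
        \<open>a - p / q\<close>.\<close>
      using *[of "- 1 / q"] by (simp add: field_simps power2_eq_square)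
  qed
  then show ?thesis
    by (simp add: p_def a_def q_def)
qed

end

section \<open>The inner product as a non-negative form\<close>

lemma cinner_self: "cinner x x = of_real ((norm (x::'a::chilbert_space))\<^sup>2)"
proof -
  have "Im (cinner x x) = 0"
    using cinner_commute[of x x] by (simp add: complex_eq_iff)
  then show ?thesis
    by (simp add: complex_eq_iff Re_cinner power2_norm_eq_inner)
qed

lemma cinner_add_right: "cinner x (y + w) = cinner x y + cinner (x::'a::chilbert_space) w"
  by (metis cinner_add_left cinner_commute complex_cnj_add)

lemma cinner_scaleC_right: "cinner x (c *\<^sub>C y) = cnj c * cinner (x::'a::chilbert_space) y"
  by (metis cinner_commute cinner_scaleC_left complex_cnj_mult)

interpretation cinner: nonneg_form UNIV cinner
  by unfold_locales
    (auto simp: sesquilinear_on_def cinner_add_left cinner_add_right cinner_scaleC_left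
      cinner_scaleC_right cinner_self simp del: of_real_power)

lemma norm_cinner_le: "cmod (cinner x y) \<le> norm x * norm (y::'a::chilbert_space)"
proof (rule power2_le_imp_le)
  show "(cmod (cinner x y))\<^sup>2 \<le> (norm x * norm y)\<^sup>2"
    using cinner.cauchy_schwarz_sq[of x y]
    by (simp add: cinner_self power_mult_distrib del: of_real_power)
qed simp

lemma cinner_zero_left [simp]: "cinner 0 (x::'a::chilbert_space) = 0"
  using cinner_scaleC_left[of 0 0 x] by simp

lemma cinner_eqI: "(\<And>v. cinner x v = cinner y v) \<Longrightarrow> x = (y::'a::chilbert_space)"
  using cinner.diff_left[of x y "x - y"] by (simp add: cinner_self)

lemma cinner_eqI_right: "(\<And>v. cinner v x = cinner v y) \<Longrightarrow> x = (y::'a::chilbert_space)"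
  by (rule cinner_eqI) (subst (1 2) cinner_commute, simp)

text \<open>The norm belongs to the real structure, so complex homogeneity is read off from
  \<open>cinner_self\<close>.\<close>

lemma norm_scaleC: "norm (c *\<^sub>C (x::'a::chilbert_space)) = cmod c * norm x"
proof (rule power2_eq_imp_eq)
  have "of_real ((norm (c *\<^sub>C x))\<^sup>2) = c * (cnj c * of_real ((norm x)\<^sup>2))"
    by (simp only: cinner_self[symmetric] cinner_scaleC_left cinner_scaleC_right mult_ac)
  also have "\<dots> = of_real ((cmod c * norm x)\<^sup>2)"
    by (simp only: power_mult_distrib of_real_mult complex_norm_square mult.assoc)
  finally show "(norm (c *\<^sub>C x))\<^sup>2 = (cmod c * norm x)\<^sup>2"
    using of_real_eq_iff by blast
qed simp_all

section \<open>Closed forms and their resolvents\<close>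

text \<open>For \<open>z = -1\<close> this is the inner product of the form domain. For general
  \<open>z\<close> the weak equation \<open>(H - z) u = F\<close> reads
  \<open>shift_form h z u v = F v\<close> for all \<open>v\<close> in the domain.\<close>

definition shift_form :: "('a::chilbert_space \<Rightarrow> 'a \<Rightarrow> complex) \<Rightarrow> complex \<Rightarrow> 'a \<Rightarrow> 'a \<Rightarrow> complex" where
  "shift_form h z u v = h u v - z * cinner u v"

lemma sesquilinear_on_shift_form:
  "sesquilinear_on V h \<Longrightarrow> sesquilinear_on V (shift_form h z)"
  by (auto simp: sesquilinear_on_def shift_form_def cinner_add_left cinner_add_right
      cinner_scaleC_left cinner_scaleC_right algebra_simps)

lemma mem_op_shift_form_op:
  "(u, f) \<in> op_shift (form_op V h) z \<longleftrightarrow> u \<in> V \<and> (\<forall>v\<in>V. shift_form h z u v = cinner f v)"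
proof -
  have "(u, f) \<in> op_shift (form_op V h) z \<longleftrightarrow> (u, f + z *\<^sub>C u) \<in> form_op V h"
    unfolding op_shift_def by (auto simp: algebra_simps)
  then show ?thesis
    by (simp add: form_op_def shift_form_def cinner_add_left cinner_scaleC_left algebra_simps)
qed

lemma antidualD:
  assumes "F \<in> antidual V n"
  shows "u \<in> V \<Longrightarrow> v \<in> V \<Longrightarrow> F (u + v) = F u + F v" "u \<in> V \<Longrightarrow> F (c *\<^sub>C u) = cnj c * F u"
    "\<exists>C. \<forall>u\<in>V. cmod (F u) \<le> C * n u" "F \<in> extensional V"
  using assms by (auto simp: antidual_def)

text \<open>First-order condition of a minimisation: for small \<open>t\<close> of sign opposite to
  \<open>a\<close> the linear term would win.\<close>

lemma quadratic_nonneg_imp_linear_zero: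
  fixes a q :: real
  assumes "0 \<le> q" and *: "\<And>t. 0 \<le> 2 * t * a + t\<^sup>2 * q"
  shows "a = 0"
proof (rule ccontr)
  assume "a \<noteq> 0"
  \<comment> \<open>The denominator \<open>q + 1\<close> also covers \<open>q = 0\<close> and keeps
    \<open>s * q\<close> at most 1.\<close>
  define s where "s = 1 / (q + 1)"
  have s: "0 < s" "s * q \<le> 1"
    using assms(1) by (auto simp: s_def field_simps)
  have "2 * (- a * s) * a + (- a * s)\<^sup>2 * q = - (a\<^sup>2 * s * (2 - s * q))"
    by (simp add: power2_eq_square algebra_simps)
  moreover have "0 < a\<^sup>2 * s * (2 - s * q)"
    using \<open>a \<noteq> 0\<close> s by (intro mult_pos_pos) auto
  ultimately show False
    using *[of "- a * s"] by simp
qed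

section \<open>Closed forms: energy inner product and Riesz representation\<close>

locale closed_form =
  fixes V :: "'a::chilbert_space set" and h :: "'a \<Rightarrow> 'a \<Rightarrow> complex"
  assumes closed_form: "closed_nonneg_form V h"
begin

lemma subspace: "csubspace V" and sesquilinear: "sesquilinear_on V h"
  and form_nonneg: "u \<in> V \<Longrightarrow> h u u \<in> \<real> \<and> 0 \<le> Re (h u u)"
  using closed_form by (auto simp: closed_nonneg_form_def)

lemma complete:
  assumes "\<And>n. X n \<in> V" "\<And>e. 0 < e \<Longrightarrow> \<exists>M. \<forall>i\<ge>M. \<forall>j\<ge>M. form_norm h (X i - X j) < e"
  shows "\<exists>u\<in>V. (\<lambda>n. form_norm h (X n - u)) \<longlonglongrightarrow> 0"
proof -
  have "\<forall>X. (\<forall>n. X n \<in> V) \<and>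
      (\<forall>e>0. \<exists>M::nat. \<forall>m\<ge>M. \<forall>n\<ge>M. form_norm h (X m - X n) < e) \<longrightarrow>
      (\<exists>u\<in>V. (\<lambda>n. form_norm h (X n - u)) \<longlonglongrightarrow> 0)"
    using closed_form unfolding closed_nonneg_form_def by (elim conjE)
  from spec[OF this, of X] show ?thesis
    using assms by simp
qed

sublocale form: nonneg_form V h
  by unfold_locales (use subspace sesquilinear form_nonneg in auto)

sublocale shift: sesquilinear_form V "shift_form h z" for z
  by unfold_locales (use subspace sesquilinear sesquilinear_on_shift_form in auto)

lemma shift_form_diag:
  assumes "u \<in> V"
  shows "shift_form h (-1) u u = of_real ((form_norm h u)\<^sup>2)"
proof -
  have "0 \<le> Re (h u u) + (norm u)\<^sup>2"
    using form_nonneg[OF assms] by simp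
  then show ?thesis
    using assms by (simp add: shift_form_def cinner_self form_norm_def complex_eq_iff)
qed

sublocale energy: nonneg_form V "shift_form h (-1)"
  by unfold_locales (simp add: shift_form_diag del: of_real_power)

lemma shift_form_commute:
  "u \<in> V \<Longrightarrow> v \<in> V \<Longrightarrow> shift_form h z u v = cnj (shift_form h (cnj z) v u)"
  using form.hermitian[of u v] cinner_commute[of u v] by (simp add: shift_form_def)

lemma shift_form_shift: "shift_form h z u v = shift_form h w u v - (z - w) * cinner u v"
  by (simp add: shift_form_def algebra_simps)

lemma form_norm_nonneg [simp]: "u \<in> V \<Longrightarrow> 0 \<le> form_norm h u"
  using form_nonneg by (simp add: form_norm_def)

lemma norm_le_form_norm: "u \<in> V \<Longrightarrow> norm u \<le> form_norm h u"
  using form_nonneg by (simp add: form_norm_def real_le_rsqrt)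

lemma energy_le:
  assumes "u \<in> V" "v \<in> V"
  shows "cmod (shift_form h (-1) u v) \<le> form_norm h u * form_norm h v"
proof (rule power2_le_imp_le)
  show "(cmod (shift_form h (-1) u v))\<^sup>2 \<le> (form_norm h u * form_norm h v)\<^sup>2"
    using energy.cauchy_schwarz_sq[OF assms] assms
    by (simp add: shift_form_diag power_mult_distrib del: of_real_power)
qed (use assms in simp)

text \<open>Relative to the energy the shifted form differs by \<open>(z + 1) * cinner u v\<close>,
  and the form norm controls both terms. Thus \<open>shift_form h z u\<close> may serve as a
  right-hand side in the dual.\<close>

lemma shift_form_bounded:
  assumes "u \<in> V"
  shows "\<exists>C. \<forall>v\<in>V. cmod (shift_form h z u v) \<le> C * form_norm h v"
proof (intro exI ballI)
  fix v assume v: "v \<in> V"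
  have "cmod (shift_form h z u v) \<le> cmod (shift_form h (-1) u v) + cmod ((z + 1) * cinner u v)"
    using shift_form_shift[of z u v "-1"] by (metis diff_minus_eq_add norm_triangle_ineq4)
  also have "\<dots> \<le> form_norm h u * form_norm h v + cmod (z + 1) * (norm u * form_norm h v)"
    unfolding norm_mult using assms v
    by (intro add_mono energy_le mult_left_mono order_trans[OF norm_cinner_le] norm_le_form_norm) auto
  finally show "cmod (shift_form h z u v) \<le> (form_norm h u + cmod (z + 1) * norm u) * form_norm h v"
    by (simp add: algebra_simps)
qed

text \<open>The minimiser of the energy \<open>\<parallel>u\<parallel>\<^sup>2 - 2 Re F(u)\<close> represents \<open>F\<close>; a minimising sequence is
  Cauchy by the parallelogram law.\<close>

theorem riesz:
  assumes "F \<in> antidual V (form_norm h)"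
  shows "\<exists>u\<in>V. \<forall>v\<in>V. shift_form h (-1) u v = F v"
proof -
  let ?B = "shift_form h (-1)"
  define J where "J u = Re (?B u u) - 2 * Re (F u)" for u
  note F = antidualD[OF assms]
  obtain C where C: "\<And>u. u \<in> V \<Longrightarrow> cmod (F u) \<le> C * form_norm h u"
    using F(3) by blast
  \<comment> \<open>Completing the square: \<open>J u\<close> is at least
    \<open>(form_norm h u - C)\<^sup>2 - C\<^sup>2\<close>.\<close>
  have low: "- C\<^sup>2 \<le> J u" if "u \<in> V" for u
  proof -
    have "Re (F u) \<le> C * form_norm h u"
      using C[OF that] complex_Re_le_cmod order_trans by blast
    moreover have "0 \<le> (form_norm h u - C)\<^sup>2"
      by simp
    ultimately show ?thesis
      using that by (simp add: J_def shift_form_diag power2_eq_square algebra_simps)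
  qed
  define m where "m = Inf (J ` V)"
  have bdd: "bdd_below (J ` V)"
    using low by (auto simp: bdd_below_def)
  have m_le: "m \<le> J u" if "u \<in> V" for u
    unfolding m_def using bdd that by (simp add: cInf_lower)
  have "\<exists>u\<in>V. J u < m + 1 / Suc n" for n
    using cInf_lessD[of "J ` V" "m + 1 / Suc n"] form.zero_mem unfolding m_def by fastforce
  then obtain X where X: "\<And>n. X n \<in> V" "\<And>n. J (X n) < m + 1 / Suc n"
    by metis
  have par: "(form_norm h (u - v))\<^sup>2 = 2 * J u + 2 * J v - 4 * J ((1/2) *\<^sub>C (u + v))"
    if "u \<in> V" "v \<in> V" for u v
  proof -
    have "(form_norm h (u - v))\<^sup>2 = Re (?B (u - v) (u - v))"
      using that by (simp add: shift_form_diag del: of_real_power)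
    then show ?thesis
      using that by (simp add: J_def shift.diff_left shift.diff_right shift.add_left
          shift.add_right shift.scaleC_left shift.scaleC_right F field_simps)
  qed
  \<comment> \<open>Both values of \<open>J\<close> exceed the infimum by less than
    \<open>1 / Suc N\<close> and the value at the midpoint is not below it, so \<open>par\<close>
    leaves \<open>4 / Suc N\<close>.\<close>
  have cauchy: "(form_norm h (X i - X j))\<^sup>2 < 4 / Suc N" if "N \<le> i" "N \<le> j" for i j N
  proof -
    have "1 / real (Suc i) \<le> 1 / Suc N" "1 / real (Suc j) \<le> 1 / Suc N"
      using that by (simp_all add: frac_le)
    then show ?thesis
      using par[OF X(1) X(1), of i j] X(2)[of i] X(2)[of j] m_le[of "(1/2) *\<^sub>C (X i + X j)"] X(1)
      by simp
  qed
  have "\<exists>M. \<forall>i\<ge>M. \<forall>j\<ge>M. form_norm h (X i - X j) < e" if "e > 0" for e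
  proof -
    have "0 < e\<^sup>2 / 4"
      using that by simp
    then obtain M where "inverse (real (Suc M)) < e\<^sup>2 / 4"
      using reals_Archimedean by blast
    then have M: "4 / real (Suc M) < e\<^sup>2"
      by (simp add: inverse_eq_divide)
    show ?thesis
    proof (intro exI allI impI)
      fix i j assume "M \<le> i" "M \<le> j"
      then have "(form_norm h (X i - X j))\<^sup>2 < e\<^sup>2"
        using cauchy[of M i j] M by linarith
      then show "form_norm h (X i - X j) < e"
        using that by (simp add: power2_less_imp_less)
    qed
  qed
  with complete X(1) have "\<exists>u\<in>V. (\<lambda>n. form_norm h (X n - u)) \<longlonglongrightarrow> 0"
    by blast
  then obtain u where u: "u \<in> V" and lim: "(\<lambda>n. form_norm h (X n - u)) \<longlonglongrightarrow> 0"
    by blast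
  \<comment> \<open>Minimality only sees real parts. Comparing \<open>m\<close> with
    \<open>J\<close> at \<open>X n + of_real t *\<^sub>C v\<close> and letting \<open>n\<close> tend
    to infinity gives a non-negative quadratic in \<open>t\<close> without constant term.\<close>
  have Re_eq: "Re (?B u v) = Re (F v)" if v: "v \<in> V" for v
  proof -
    have "(\<lambda>n. ?B (X n - u) v) \<longlonglongrightarrow> 0"
      by (rule Lim_null_comparison[OF _ tendsto_mult_left_zero[OF lim, of "form_norm h v"]])
        (use energy_le X(1) u v in auto)
    then have "(\<lambda>n. ?B (X n) v - ?B u v) \<longlonglongrightarrow> 0"
      using X(1) u v by (simp add: shift.diff_left)
    then have Blim: "(\<lambda>n. ?B (X n) v) \<longlonglongrightarrow> ?B u v"
      by (simp add: LIM_zero_iff)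
    have inv_lim: "(\<lambda>n. 1 / real (Suc n)) \<longlonglongrightarrow> 0"
      by (rule LIMSEQ_Suc[OF lim_1_over_n])
    have "0 \<le> 2 * t * (Re (?B u v) - Re (F v)) + t\<^sup>2 * (form_norm h v)\<^sup>2" for t
    proof -
      have "0 \<le> 1 / Suc n + (2 * t * (Re (?B (X n) v) - Re (F v)) + t\<^sup>2 * (form_norm h v)\<^sup>2)" for n
      proof -
        have "J (X n + of_real t *\<^sub>C v) =
            J (X n) + 2 * t * (Re (?B (X n) v) - Re (F v)) + t\<^sup>2 * (form_norm h v)\<^sup>2"
          using X(1)[of n] v energy.hermitian[of v "X n"]
          by (simp add: J_def shift.add_left shift.add_right shift.scaleC_left shift.scaleC_right
              F shift_form_diag[OF v] power2_eq_square algebra_simps)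
        then show ?thesis
          using m_le[of "X n + of_real t *\<^sub>C v"] X[of n] v by simp
      qed
      moreover have "(\<lambda>n. 1 / Suc n + (2 * t * (Re (?B (X n) v) - Re (F v)) + t\<^sup>2 * (form_norm h v)\<^sup>2))
          \<longlonglongrightarrow> 0 + (2 * t * (Re (?B u v) - Re (F v)) + t\<^sup>2 * (form_norm h v)\<^sup>2)"
        by (intro tendsto_intros Blim inv_lim)
      ultimately have "0 \<le> 0 + (2 * t * (Re (?B u v) - Re (F v)) + t\<^sup>2 * (form_norm h v)\<^sup>2)"
        by (intro LIMSEQ_le_const) blast+
      then show ?thesis
        by simp
    qed
    then have "Re (?B u v) - Re (F v) = 0"
      by (rule quadratic_nonneg_imp_linear_zero[rotated]) simp
    then show ?thesis by simp
  qed
  have "?B u v = F v" if v: "v \<in> V" for v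
    \<comment> \<open>Both sides are antilinear in \<open>v\<close>, so the test with
      \<open>\<i> *\<^sub>C v\<close> recovers the imaginary parts.\<close>
    using Re_eq[OF v] Re_eq[of "\<i> *\<^sub>C v"] u v
    by (simp add: complex_eq_iff shift.scaleC_right F)
  with u show ?thesis by blast
qed

end

section \<open>The resolvent set in terms of the weak equation\<close>

lemma (in closed_form) mem_resolvent_set:
  "z \<in> resolvent_set (form_op V h) \<longleftrightarrow>
     (\<forall>f. \<exists>!u. u \<in> V \<and> (\<forall>v\<in>V. shift_form h z u v = cinner f v)) \<and>
     (\<exists>C. \<forall>u\<in>V. \<forall>f. (\<forall>v\<in>V. shift_form h z u v = cinner f v) \<longrightarrow> norm u \<le> C * norm f)"
proof -
  have "(\<forall>(u, f) \<in> op_shift (form_op V h) z. norm u \<le> C * norm f) \<longleftrightarrow>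
      (\<forall>u\<in>V. \<forall>f. (\<forall>v\<in>V. shift_form h z u v = cinner f v) \<longrightarrow> norm u \<le> C * norm f)" for C
    unfolding Ball_def[of "op_shift (form_op V h) z"] split_paired_All prod.case mem_op_shift_form_op
    by blast
  then show ?thesis
    by (simp add: resolvent_set_def mem_op_shift_form_op)
qed

text \<open>For the zero form, \<open>form_norm\<close> is the norm and the energy is the inner
  product, so \<open>riesz\<close> becomes the Riesz theorem of the Hilbert space itself.\<close>

lemma closed_form_UNIV_zero: "closed_form (UNIV :: 'a::chilbert_space set) (\<lambda>_ _. 0)"
proof (rule closed_form.intro)
  have "\<exists>u. (\<lambda>n. norm (X n - u)) \<longlonglongrightarrow> 0"
    if *: "\<forall>e>0. \<exists>M::nat. \<forall>m\<ge>M. \<forall>n\<ge>M. norm (X m - X n) < e" for X :: "nat \<Rightarrow> 'a"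
  proof -
    have "Cauchy X"
      using * by (simp add: Cauchy_def dist_norm)
    then obtain u where "X \<longlonglongrightarrow> u"
      using Cauchy_convergent convergentD by blast
    then show ?thesis
      using LIM_zero tendsto_norm_zero by blast
  qed
  then show "closed_nonneg_form (UNIV :: 'a set) (\<lambda>_ _. 0)"
    by (simp add: closed_nonneg_form_def sesquilinear_on_def form_norm_def)
qed

text \<open>Riesz applied to \<open>\<lambda>x. cinner y (T x)\<close> gives existence,
  nondegeneracy of the inner product gives uniqueness; the description defining
  \<open>cadjoint\<close> thus has a value.\<close>

lemma cadjoint:
  fixes T :: "'a::chilbert_space \<Rightarrow> 'b::chilbert_space"
  assumes "bounded_clinear T"
  shows "cinner (T x) y = cinner x (cadjoint T y)"
proof -
  obtain C where C: "\<And>x. norm (T x) \<le> C * norm x"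
    using assms by (auto simp: bounded_clinear_def)
  have T: "T (u + v) = T u + T v" "T (c *\<^sub>C u) = c *\<^sub>C T u" for u v c
    using assms by (auto simp: bounded_clinear_def clinear_on_def)
  interpret closed_form "UNIV :: 'a set" "\<lambda>_ _. 0"
    by (rule closed_form_UNIV_zero)
  have "\<exists>w. \<forall>x. cinner (T x) y = cinner x w" for y
  proof -
    have "cmod (cinner y (T x)) \<le> norm y * C * norm x" for x
      using norm_cinner_le[of y "T x"] mult_left_mono[OF C[of x] norm_ge_zero[of y]] by (simp add: mult.assoc)
    then have "(\<lambda>x. cinner y (T x)) \<in> antidual UNIV (form_norm (\<lambda>_ _. 0))"
      by (auto simp: antidual_def T cinner_add_right cinner_scaleC_right form_norm_def)
    then obtain w where "\<And>x. cinner w x = cinner y (T x)"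
      using riesz by (fastforce simp: shift_form_def)
    then have "\<forall>x. cinner (T x) y = cinner x w"
      by (metis cinner_commute)
    then show ?thesis ..
  qed
  then have "\<forall>y. \<exists>w. \<forall>x. cinner (T x) y = cinner x w"
    by blast
  from choice[OF this] obtain T' where T': "\<forall>x y. cinner (T x) y = cinner x (T' y)"
    by blast
  have "cadjoint T = T'"
    unfolding cadjoint_def
  proof (rule the_equality)
    fix T'' assume T'': "\<forall>x y. cinner (T x) y = cinner x (T'' y)"
    have "T'' y = T' y" for y
      by (rule cinner_eqI_right) (metis T' T'')
    then show "T'' = T'"
      by blast
  qed (rule T')
  then show ?thesis
    using T' by simp
qed

section \<open>Strong and weak resolvents at a regular point\<close>

locale regular_form = closed_form +
  fixes z :: complex
  assumes resolvent_set: "z \<in> resolvent_set (form_op V h)"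
begin

definition R :: "'a \<Rightarrow> 'a" where
  "R = resolvent (form_op V h) z"

text \<open>Linearity, injectivity and the resolvent identity are later obtained by verifying the
  right-hand side.\<close>

lemma R_eq_iff: "u = R f \<longleftrightarrow> u \<in> V \<and> (\<forall>v\<in>V. shift_form h z u v = cinner f v)"
proof -
  let ?P = "\<lambda>u. u \<in> V \<and> (\<forall>v\<in>V. shift_form h z u v = cinner f v)"
  have ex1: "\<exists>!u. ?P u"
    using resolvent_set unfolding mem_resolvent_set by blast
  have R: "R f = (THE u. ?P u)"
    by (simp add: R_def resolvent_def op_inv_def mem_op_shift_form_op)
  have "?P (R f)"
    unfolding R by (rule theI'[OF ex1])
  with ex1 show ?thesis
    by blast
qed

lemma R_mem [simp]: "R f \<in> V" and shift_form_R: "v \<in> V \<Longrightarrow> shift_form h z (R f) v = cinner f v"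
  using R_eq_iff by blast+

lemma shift_form_inj:
  assumes "u \<in> V" "w \<in> V" "\<And>v. v \<in> V \<Longrightarrow> shift_form h z u v = shift_form h z w v"
  shows "u = w"
proof -
  have "u - w = R 0"
    using assms by (simp add: R_eq_iff shift.diff_left)
  moreover have "0 = R 0"
    unfolding R_eq_iff using shift.diff_left[of 0 0] by simp
  ultimately show ?thesis by simp
qed

lemma R_add: "R (f + g) = R f + R g" and R_scaleC: "R (c *\<^sub>C f) = c *\<^sub>C R f"
  by (rule sym, rule iffD2[OF R_eq_iff], simp add: shift.add_left shift.scaleC_left shift_form_R
      cinner_add_left cinner_scaleC_left)+

lemma R_bounded: "\<exists>C\<ge>0. \<forall>f. norm (R f) \<le> C * norm f"
proof -
  obtain C where "\<forall>u\<in>V. \<forall>f. (\<forall>v\<in>V. shift_form h z u v = cinner f v) \<longrightarrow> norm u \<le> C * norm f"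
    using resolvent_set[unfolded mem_resolvent_set, THEN conjunct2] by (elim exE)
  then have C: "norm (R f) \<le> C * norm f" for f
    by (simp add: shift_form_R)
  have "norm (R f) \<le> \<bar>C\<bar> * norm f" for f
    by (rule order_trans[OF C]) (simp add: mult_right_mono)
  then show ?thesis
    by (intro exI[of _ "\<bar>C\<bar>"]) simp
qed

lemma bounded_clinear_R: "bounded_clinear R"
  using R_bounded by (auto simp: bounded_clinear_def clinear_on_def R_add R_scaleC)

text \<open>Testing the equation for \<open>R f\<close> with \<open>R f\<close> itself expresses its
  energy through inner products, which the Hilbert space bound of \<open>R\<close> controls.\<close>

lemma R_form_norm_bounded: "\<exists>C\<ge>0. \<forall>f. form_norm h (R f) \<le> C * norm f"
proof -
  obtain C where C: "C \<ge> 0" "\<And>f. norm (R f) \<le> C * norm f"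
    using R_bounded by blast
  define K where "K = C + cmod (z + 1) * C\<^sup>2"
  have "(form_norm h (R f))\<^sup>2 \<le> K * (norm f)\<^sup>2" for f
  proof -
    have "(form_norm h (R f))\<^sup>2 = cmod (shift_form h (-1) (R f) (R f))"
      by (simp add: shift_form_diag norm_power)
    also have "shift_form h (-1) (R f) (R f) = cinner f (R f) + (z + 1) * cinner (R f) (R f)"
      using shift_form_shift[of "-1" "R f" "R f" z] by (simp add: shift_form_R algebra_simps)
    also have "cmod \<dots> \<le> norm f * norm (R f) + cmod (z + 1) * (norm (R f))\<^sup>2"
      using norm_cinner_le[of f "R f"] norm_triangle_ineq[of "cinner f (R f)" "(z + 1) * cinner (R f) (R f)"]
      by (simp add: norm_mult norm_power cinner_self)
    also have "\<dots> \<le> norm f * (C * norm f) + cmod (z + 1) * (C * norm f)\<^sup>2"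
      by (intro add_mono mult_left_mono power_mono C) auto
    also have "\<dots> = K * (norm f)\<^sup>2"
      by (simp add: K_def power2_eq_square algebra_simps)
    finally show ?thesis .
  qed
  then have "form_norm h (R f) \<le> sqrt K * norm f" for f
    by (metis norm_ge_zero real_le_rsqrt real_sqrt_mult real_sqrt_unique)
  moreover have "0 \<le> sqrt K"
    using C by (simp add: K_def)
  ultimately show ?thesis
    by blast
qed

text \<open>The equation is first solved at \<open>-1\<close>; the error is then an element of the Hilbert space.\<close>

lemma weak_solvable:
  assumes "F \<in> antidual V (form_norm h)"
  shows "\<exists>u\<in>V. \<forall>v\<in>V. shift_form h z u v = F v"
proof -
  obtain w where w: "w \<in> V" "\<And>v. v \<in> V \<Longrightarrow> shift_form h (-1) w v = F v"
    using riesz[OF assms] by blast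
  show ?thesis
  proof (intro bexI ballI)
    fix v assume v: "v \<in> V"
    \<comment> \<open>Passing from \<open>-1\<close> to \<open>z\<close> leaves the error
      \<open>- (z + 1) * cinner w v\<close>, which the \<open>R\<close> term cancels.\<close>
    show "shift_form h z (w + R ((z + 1) *\<^sub>C w)) v = F v"
      using v w shift_form_shift[of z w v "-1"]
      by (simp add: shift.add_left shift_form_R cinner_scaleC_left)
  qed (use w in simp)
qed

lemma weak_resolvent:
  assumes "F \<in> antidual V (form_norm h)"
  shows "weak_resolvent V h z F \<in> V"
    and "v \<in> V \<Longrightarrow> shift_form h z (weak_resolvent V h z F) v = F v"
proof -
  let ?T = "\<lambda>u. restrict (shift_form h z u) V"
  have T: "weak_resolvent V h z = the_inv_into V ?T"
    unfolding weak_resolvent_def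
    by (intro arg_cong[of _ _ "the_inv_into V"] ext)
      (auto simp: weak_op_def to_dual_def shift_form_def restrict_def)
  have inj: "inj_on ?T V"
    by (intro inj_onI shift_form_inj) (assumption | metis restrict_apply')+
  obtain u where "u \<in> V" "\<forall>v\<in>V. shift_form h z u v = F v"
    using weak_solvable[OF assms] by blast
  \<comment> \<open>Members of the dual are extensional, so agreement on \<open>V\<close> is
    equality of functions.\<close>
  then have F: "F \<in> ?T ` V"
    using antidualD(4)[OF assms] by (intro image_eqI[of _ _ u] extensionalityI[of _ V]) auto
  show "weak_resolvent V h z F \<in> V"
    unfolding T by (rule the_inv_into_into[OF inj F subset_refl])
  show "shift_form h z (weak_resolvent V h z F) v = F v" if "v \<in> V"
    using fun_cong[OF f_the_inv_into_f[OF inj F], of v] that by (simp add: T)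
qed

lemma weak_resolvent_eqI:
  assumes "F \<in> antidual V (form_norm h)" "u \<in> V" "\<And>v. v \<in> V \<Longrightarrow> shift_form h z u v = F v"
  shows "weak_resolvent V h z F = u"
  using assms by (intro shift_form_inj) (auto simp: weak_resolvent)

end

section \<open>The regular points -1 and \<open>cnj z\<close>\<close>

lemma (in closed_form) to_dual_antidual: "to_dual V f \<in> antidual V (form_norm h)"
proof -
  have "cmod (cinner f v) \<le> norm f * form_norm h v" if "v \<in> V" for v
    using norm_cinner_le[of f v] mult_left_mono[OF norm_le_form_norm[OF that] norm_ge_zero[of f]]
    by linarith
  then show ?thesis
    by (auto simp: to_dual_def antidual_def cinner_add_right cinner_scaleC_right)
qed

text \<open>Riesz gives solvability; since the energy dominates the square of the norm, uniqueness
  and the resolvent bound 1 follow. The boundary norm rests on this point.\<close>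

lemma (in closed_form) minus_one_mem_resolvent_set: "-1 \<in> resolvent_set (form_op V h)"
proof -
  have "\<exists>u\<in>V. \<forall>v\<in>V. shift_form h (-1) u v = cinner f v" for f
    using riesz[OF to_dual_antidual[of f]] by (simp add: to_dual_def)
  moreover have "u = w" if "u \<in> V" "w \<in> V" "\<forall>v\<in>V. shift_form h (-1) u v = cinner f v"
    "\<forall>v\<in>V. shift_form h (-1) w v = cinner f v" for u w f
  proof -
    have "shift_form h (-1) (u - w) (u - w) = 0"
      using that by (simp add: shift.diff_left)
    then have "form_norm h (u - w) = 0"
      using that by (simp add: shift_form_diag)
    then show ?thesis
      using norm_le_form_norm[of "u - w"] that by simp
  qed
  moreover have "norm u \<le> 1 * norm f" if "u \<in> V" "\<forall>v\<in>V. shift_form h (-1) u v = cinner f v" for u f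
  proof (cases "u = 0")
    case False
    have "norm u * norm u \<le> form_norm h u * form_norm h u"
      using that norm_le_form_norm by (intro mult_mono) auto
    also have "\<dots> = cmod (cinner f u)"
      using shift_form_diag[OF that(1)] that by (simp add: norm_power power2_eq_square norm_mult)
    also have "\<dots> \<le> norm f * norm u"
      by (rule norm_cinner_le)
    finally show ?thesis
      using False by simp
  qed simp
  ultimately show ?thesis
    unfolding mem_resolvent_set by (intro conjI allI ex_ex1I) blast+
qed

text \<open>The adjoint of \<open>R\<close> produces solutions at \<open>cnj z\<close>; pairing any
  such solution with \<open>R g\<close> gives uniqueness and the bound.\<close>

lemma (in regular_form) cnj_mem_resolvent_set: "cnj z \<in> resolvent_set (form_op V h)"
proof -
  interpret m: regular_form V h "-1"
    by unfold_locales (rule minus_one_mem_resolvent_set)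
  obtain C where C: "C \<ge> 0" "\<And>f. norm (R f) \<le> C * norm f"
    using R_bounded by blast
  have test: "cinner f (R g) = cinner u g"
    if u: "u \<in> V" "\<forall>v\<in>V. shift_form h (cnj z) u v = cinner f v" for u f g
    using shift_form_commute[of u "R g" "cnj z"] u shift_form_R[of u g] cinner_commute[of u g] by simp
  have bound: "norm u \<le> C * norm f"
    if u: "u \<in> V" "\<forall>v\<in>V. shift_form h (cnj z) u v = cinner f v" for u f
  proof (cases "u = 0")
    case False
    have "norm u * norm u = cmod (cinner f (R u))"
      using test[OF u, of u] by (simp add: cinner_self power2_eq_square norm_mult)
    also have "\<dots> \<le> norm f * (C * norm u)"
      by (rule order_trans[OF norm_cinner_le mult_left_mono[OF C(2)]]) simp
    finally show ?thesis
      using False by (simp add: algebra_simps)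
  qed (use C in simp)
  have self_adjoint: "cinner (m.R f) g = cinner f (m.R g)" for f g
    using shift_form_commute[of "m.R f" "m.R g" "-1"] cinner_commute[of "m.R f" g]
    by (simp add: m.shift_form_R)
  \<comment> \<open>The resolvent identity between \<open>-1\<close> and \<open>z\<close>; on the
    adjoint side it becomes the fixed point equation for \<open>u\<close> below.\<close>
  have "R g = m.R g + (z + 1) *\<^sub>C R (m.R g)" for g
    by (rule sym, rule iffD2[OF R_eq_iff]) (simp add: shift.add_left shift.scaleC_left shift_form_R
        shift_form_shift[of z "m.R g" _ "-1"] m.shift_form_R)
  note resolvent_identity = this
  have "\<exists>u\<in>V. \<forall>v\<in>V. shift_form h (cnj z) u v = cinner f v" for f
  proof -
    define u where "u = cadjoint R f"
    have u: "cinner u g = cinner f (R g)" for g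
      using cadjoint[OF bounded_clinear_R, of g f] by (metis cinner_commute u_def)
    \<comment> \<open>A priori \<open>u\<close> is only an element of the Hilbert space; lying in
      the range of \<open>m.R\<close> places it in \<open>V\<close>.\<close>
    have "u = m.R (f + (cnj z + 1) *\<^sub>C u)"
    proof (rule cinner_eqI)
      fix g
      show "cinner u g = cinner (m.R (f + (cnj z + 1) *\<^sub>C u)) g"
        unfolding u[of g] self_adjoint
        by (subst resolvent_identity)
          (simp add: cinner_add_left cinner_add_right cinner_scaleC_left cinner_scaleC_right u)
    qed
    then have "u \<in> V" "v \<in> V \<Longrightarrow> shift_form h (-1) u v = cinner (f + (cnj z + 1) *\<^sub>C u) v" for v
      using m.R_eq_iff by blast+
    then show ?thesis
      using shift_form_shift[of "cnj z" u _ "-1"]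
      by (intro bexI[of _ u]) (simp_all add: cinner_add_left cinner_scaleC_left)
  qed
  moreover have "u = w" if "u \<in> V" "w \<in> V" "\<forall>v\<in>V. shift_form h (cnj z) u v = cinner f v"
    "\<forall>v\<in>V. shift_form h (cnj z) w v = cinner f v" for u w f
    by (rule cinner_eqI) (metis test that)
  ultimately show ?thesis
    unfolding mem_resolvent_set using bound by (intro conjI allI ex_ex1I) blast+
qed

section \<open>Boundary pairs\<close>

lemma antidual_bound:
  assumes "F \<in> antidual V n" "\<And>u. u \<in> V \<Longrightarrow> 0 \<le> n u"
  obtains C where "0 \<le> C" "\<And>u. u \<in> V \<Longrightarrow> cmod (F u) \<le> C * n u"
proof -
  obtain C where C: "\<And>u. u \<in> V \<Longrightarrow> cmod (F u) \<le> C * n u"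
    using antidualD(3)[OF assms(1)] by blast
  have "cmod (F u) \<le> \<bar>C\<bar> * n u" if "u \<in> V" for u
    using C[OF that] mult_right_mono[OF abs_ge_self[of C] assms(2)[OF that]] by linarith
  then show ?thesis
    using that[of "\<bar>C\<bar>"] by simp
qed

lemma antidual_restrict: "F \<in> antidual V n \<Longrightarrow> csubspace W \<Longrightarrow> W \<subseteq> V \<Longrightarrow> restrict F W \<in> antidual W n"
  unfolding antidual_def csubspace_def by (auto simp: subset_iff) meson

text \<open>Boundedness makes \<open>T\<close> uniformly continuous, hence extendable to the
  closure. Linearity and the bound pass to limits of sequences, and two continuous extensions agree
  on a closed set containing \<open>V\<close>.\<close>

lemma dense_extension_ex1:
  fixes T :: "'a::chilbert_space \<Rightarrow> 'b::chilbert_space"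
  assumes V: "csubspace V" "closure V = UNIV" and T: "clinear_on V T"
    and C: "\<And>x. x \<in> V \<Longrightarrow> norm (T x) \<le> C * norm x"
  shows "\<exists>!T'. bounded_clinear T' \<and> (\<forall>x\<in>V. T' x = T x)"
proof -
  have lim_unique: "P = Q" if "\<forall>x\<in>V. P x = Q x" "continuous_on UNIV P" "continuous_on UNIV Q"
    for P Q :: "'a \<Rightarrow> 'b"
  proof
    fix x
    have "closed {x. P x = Q x}"
      using that by (intro closed_Collect_eq) (auto simp: continuous_on_eq_continuous_at)
    then have "closure V \<subseteq> {x. P x = Q x}"
      using that by (intro closure_minimal) auto
    then show "P x = Q x"
      using V by auto
  qed
  have "uniformly_continuous_on V T"
    unfolding uniformly_continuous_on_def
  proof (intro allI impI)
    fix e :: real assume "0 < e"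
    show "\<exists>d>0. \<forall>x\<in>V. \<forall>x'\<in>V. dist x' x < d \<longrightarrow> dist (T x') (T x) < e"
    proof (intro exI conjI ballI impI)
      \<comment> \<open>The denominator is positive whatever the sign of \<open>C\<close>.\<close>
      show "0 < e / (\<bar>C\<bar> + 1)"
        using \<open>0 < e\<close> by simp
      fix x x' assume "x \<in> V" "x' \<in> V" and d: "dist x' x < e / (\<bar>C\<bar> + 1)"
      then have "dist (T x') (T x) \<le> C * dist x' x"
        using C[of "x' - x"] V by (simp add: dist_norm csubspace_diff clinear_on_diff[OF V(1) T, symmetric])
      also have "\<dots> \<le> (\<bar>C\<bar> + 1) * dist x' x"
        by (intro mult_right_mono) auto
      also have "\<dots> < e"
        using d by (simp add: field_simps)
      finally show "dist (T x') (T x) < e" .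
    qed
  qed
  then obtain g where "uniformly_continuous_on (closure V) g" and g: "\<And>x. x \<in> V \<Longrightarrow> T x = g x"
    by (rule uniformly_continuous_on_extension_on_closure) (rule that)
  then have cont: "isCont g x" for x
    using uniformly_continuous_imp_continuous[of UNIV g] V by (simp add: continuous_on_eq_continuous_at)
  have seq: "\<exists>X. (\<forall>n. X n \<in> V) \<and> X \<longlonglongrightarrow> x" for x
    using V(2) closure_sequential[of x V] by auto
  have g_seq: "(\<lambda>n. T (X n)) \<longlonglongrightarrow> g x" if "\<And>n. X n \<in> V" "X \<longlonglongrightarrow> x" for X x
    using isCont_tendsto_compose[OF cont that(2)] g that(1) by simp
  have scaleC_lim: "(\<lambda>n. c *\<^sub>C X n) \<longlonglongrightarrow> c *\<^sub>C x" if "X \<longlonglongrightarrow> x" for c and X :: "nat \<Rightarrow> 'c::chilbert_space" and x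
  proof (rule LIM_zero_cancel, rule Lim_null_comparison)
    show "(\<lambda>n. cmod c * norm (X n - x)) \<longlonglongrightarrow> 0"
      using that by (intro tendsto_mult_right_zero tendsto_norm_zero LIM_zero)
  qed (simp add: norm_scaleC flip: scaleC_diff_right)
  have "g (x + y) = g x + g y" for x y
  proof -
    obtain X Y where X: "\<And>n. X n \<in> V" "X \<longlonglongrightarrow> x" and Y: "\<And>n. Y n \<in> V" "Y \<longlonglongrightarrow> y"
      using seq by metis
    have "(\<lambda>n. T (X n + Y n)) \<longlonglongrightarrow> g (x + y)"
      using X Y V(1) by (intro g_seq tendsto_add) (auto simp: csubspace_def)
    moreover have "(\<lambda>n. T (X n + Y n)) = (\<lambda>n. T (X n) + T (Y n))"
      using X Y T by (simp add: clinear_on_def)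
    moreover have "(\<lambda>n. T (X n) + T (Y n)) \<longlonglongrightarrow> g x + g y"
      by (intro tendsto_add g_seq X Y)
    ultimately show ?thesis
      using LIMSEQ_unique by metis
  qed
  moreover have "g (c *\<^sub>C x) = c *\<^sub>C g x" and "norm (g x) \<le> C * norm x" for c x
  proof -
    obtain X where X: "\<And>n. X n \<in> V" "X \<longlonglongrightarrow> x"
      using seq by metis
    have "(\<lambda>n. T (c *\<^sub>C X n)) \<longlonglongrightarrow> g (c *\<^sub>C x)"
      using X V(1) by (intro g_seq scaleC_lim) (auto simp: csubspace_def)
    moreover have "(\<lambda>n. T (c *\<^sub>C X n)) = (\<lambda>n. c *\<^sub>C T (X n))"
      using X T by (simp add: clinear_on_def)
    moreover have "(\<lambda>n. c *\<^sub>C T (X n)) \<longlonglongrightarrow> c *\<^sub>C g x"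
      by (intro scaleC_lim g_seq X)
    ultimately show "g (c *\<^sub>C x) = c *\<^sub>C g x"
      using LIMSEQ_unique by metis
    have "(\<lambda>n. norm (T (X n))) \<longlonglongrightarrow> norm (g x)" "(\<lambda>n. C * norm (X n)) \<longlonglongrightarrow> C * norm x"
      by (intro tendsto_intros g_seq X)+
    then show "norm (g x) \<le> C * norm x"
      using C X(1) by (rule_tac LIMSEQ_le) auto
  qed
  ultimately have "bounded_clinear g"
    by (auto simp: bounded_clinear_def clinear_on_def)
  moreover have "continuous_on UNIV P" if P: "bounded_clinear P" for P :: "'a \<Rightarrow> 'b"
  proof -
    obtain K where K: "\<And>x. norm (P x) \<le> K * norm x"
      using P by (auto simp: bounded_clinear_def)
    have "bounded_linear P"
      using P K scaleC_of_real by (intro bounded_linear_intro[of _ K])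
        (auto simp: bounded_clinear_def clinear_on_def mult.commute simp flip: scaleC_of_real)
    then show ?thesis
      by (simp add: linear_continuous_on)
  qed
  ultimately show ?thesis
    using g lim_unique by (intro ex1I[of _ g]) auto
qed

section \<open>Dirichlet form, weak solutions and solution operators\<close>

locale boundary = closed_form D h
  for D :: "'h::chilbert_space set" and h :: "'h \<Rightarrow> 'h \<Rightarrow> complex" +
  fixes \<Gamma> :: "'h \<Rightarrow> 'g::chilbert_space"
  assumes boundary_pair: "boundary_pair D h \<Gamma>"
begin

abbreviation "DD \<equiv> dirichlet_dom D \<Gamma>"
abbreviation "N \<equiv> weak_solutions D h \<Gamma>"
abbreviation "S \<equiv> solution_op D h \<Gamma>"

lemma trace_linear: "clinear_on D \<Gamma>"
  and dirichlet_dense: "closure DD = UNIV"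
  and trace_dense: "closure (\<Gamma> ` D) = UNIV"
  using boundary_pair by (auto simp: boundary_pair_def)

lemma trace_add: "u \<in> D \<Longrightarrow> v \<in> D \<Longrightarrow> \<Gamma> (u + v) = \<Gamma> u + \<Gamma> v"
  and trace_scaleC: "u \<in> D \<Longrightarrow> \<Gamma> (c *\<^sub>C u) = c *\<^sub>C \<Gamma> u"
  using trace_linear by (auto simp: clinear_on_def)

lemma trace_diff: "u \<in> D \<Longrightarrow> v \<in> D \<Longrightarrow> \<Gamma> (u - v) = \<Gamma> u - \<Gamma> v"
  by (rule clinear_on_diff[OF subspace trace_linear])

lemma trace_zero: "\<Gamma> 0 = 0"
  using trace_diff[of 0 0] by simp

lemma trace_bounded: "\<exists>C\<ge>0. \<forall>u\<in>D. norm (\<Gamma> u) \<le> C * form_norm h u"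
proof -
  obtain C where C: "\<And>u. u \<in> D \<Longrightarrow> norm (\<Gamma> u) \<le> C * form_norm h u"
    using boundary_pair by (auto simp: boundary_pair_def)
  have "norm (\<Gamma> u) \<le> \<bar>C\<bar> * form_norm h u" if "u \<in> D" for u
    using C[OF that] mult_right_mono[OF abs_ge_self[of C] form_norm_nonneg[OF that]] by linarith
  then show ?thesis
    by (intro exI[of _ "\<bar>C\<bar>"]) simp
qed

lemma mem_dirichlet: "u \<in> DD \<longleftrightarrow> u \<in> D \<and> \<Gamma> u = 0"
  by (simp add: dirichlet_dom_def)

lemma dirichlet_mem [simp]: "u \<in> DD \<Longrightarrow> u \<in> D"
  by (simp add: mem_dirichlet)

lemma csubspace_dirichlet: "csubspace DD"
  unfolding csubspace_def by (simp add: mem_dirichlet trace_zero trace_add trace_scaleC)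

lemma csubspace_trace: "csubspace (\<Gamma> ` D)"
  unfolding csubspace_def
proof (intro conjI allI ballI)
  show "0 \<in> \<Gamma> ` D"
    using trace_zero form.zero_mem by (metis imageI)
qed (auto simp flip: trace_add trace_scaleC)

text \<open>The kernel of a map bounded in the form norm is closed in that norm. All results on
  closed forms thereby apply to the Dirichlet form too.\<close>

lemma closed_form_dirichlet: "closed_form DD h"
proof (rule closed_form.intro)
  have "\<exists>u\<in>DD. (\<lambda>n. form_norm h (X n - u)) \<longlonglongrightarrow> 0"
    if X: "\<And>n. X n \<in> DD"
      and cauchy: "\<And>e. 0 < e \<Longrightarrow> \<exists>M. \<forall>i\<ge>M. \<forall>j\<ge>M. form_norm h (X i - X j) < e"
    for X :: "nat \<Rightarrow> 'h"
  proof -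
    obtain u where u: "u \<in> D" and lim: "(\<lambda>n. form_norm h (X n - u)) \<longlonglongrightarrow> 0"
      using complete[OF dirichlet_mem[OF X] cauchy] by blast
    obtain C where C: "\<And>u. u \<in> D \<Longrightarrow> norm (\<Gamma> u) \<le> C * form_norm h u"
      using trace_bounded by blast
    have "norm (\<Gamma> u) \<le> C * form_norm h (X n - u)" for n
      using C[of "X n - u"] X[of n] u by (simp add: trace_diff mem_dirichlet)
    moreover have "(\<lambda>n. C * form_norm h (X n - u)) \<longlonglongrightarrow> 0"
      by (rule tendsto_mult_right_zero[OF lim])
    ultimately have "norm (\<Gamma> u) \<le> 0"
      by (intro LIMSEQ_le_const) auto
    with u lim show ?thesis
      by (auto simp: mem_dirichlet)
  qed
  then show "closed_nonneg_form DD h"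
    unfolding closed_nonneg_form_def
    using csubspace_dirichlet dirichlet_dense sesquilinear_on_subset[OF sesquilinear, of DD] form_nonneg
    by (intro conjI) (auto simp: subset_iff)
qed

sublocale dir: closed_form DD h
  by (rule closed_form_dirichlet)

abbreviation "dirichlet_regular z \<equiv> z \<in> resolvent_set (form_op DD h)"
abbreviation "RD z \<equiv> resolvent (form_op DD h) z"

lemma dirichlet_regular_form: "dirichlet_regular z \<Longrightarrow> regular_form DD h z"
  by unfold_locales

lemma mem_weak_solutions: "u \<in> N z \<longleftrightarrow> u \<in> D \<and> (\<forall>f\<in>DD. shift_form h z u f = 0)"
  by (simp add: weak_solutions_def shift_form_def)

lemma weak_solutions_mem: "u \<in> N z \<Longrightarrow> u \<in> D"
  by (simp add: mem_weak_solutions)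

lemma csubspace_weak_solutions: "csubspace (N z)"
  using shift.diff_left[of 0 0]
  by (auto simp: csubspace_def mem_weak_solutions shift.add_left shift.scaleC_left)

text \<open>The difference has zero trace and solves the homogeneous Dirichlet equation.\<close>

lemma weak_solutions_inj:
  assumes "dirichlet_regular z" "u \<in> N z" "w \<in> N z" "\<Gamma> u = \<Gamma> w"
  shows "u = w"
proof -
  interpret r: regular_form DD h z
    by (rule dirichlet_regular_form[OF assms(1)])
  have "u - w \<in> DD"
    using assms(2-) by (simp add: mem_weak_solutions mem_dirichlet trace_diff)
  then have "u - w = 0"
    using assms(2,3) shift.diff_left[of 0 0]
    by (intro r.shift_form_inj) (simp_all add: mem_weak_solutions shift.diff_left)
  then show ?thesis by simp
qed

text \<open>Take \<open>p = u - d\<close>, with \<open>d\<close> the Dirichlet solution for the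
  functional \<open>shift_form h z u\<close>. This is the existence half of the splitting of
  \<open>D\<close> into \<open>DD\<close> and \<open>N z\<close>.\<close>

lemma weak_solution_exists:
  assumes z: "dirichlet_regular z" and u: "u \<in> D"
  shows "\<exists>p\<in>N z. u - p \<in> DD"
proof -
  interpret r: regular_form DD h z
    by (rule dirichlet_regular_form[OF z])
  obtain C where C: "\<And>v. v \<in> D \<Longrightarrow> cmod (shift_form h z u v) \<le> C * form_norm h v"
    using shift_form_bounded[OF u] by blast
  then have "\<forall>v\<in>DD. cmod (shift_form h z u v) \<le> C * form_norm h v"
    by simp
  then have "\<exists>C. \<forall>v\<in>DD. cmod (shift_form h z u v) \<le> C * form_norm h v"
    by blast
  then have "restrict (shift_form h z u) DD \<in> antidual DD (form_norm h)"
    using u by (simp add: antidual_def shift.add_right shift.scaleC_right)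
  then obtain d where d: "d \<in> DD" "\<And>v. v \<in> DD \<Longrightarrow> shift_form h z d v = shift_form h z u v"
    using r.weak_solvable by fastforce
  show ?thesis
    using d u by (intro bexI[of _ "u - d"]) (auto simp: mem_weak_solutions shift.diff_left)
qed

lemma bij_betw_trace:
  assumes "dirichlet_regular z"
  shows "bij_betw \<Gamma> (N z) (\<Gamma> ` D)"
proof (rule bij_betw_imageI)
  show "inj_on \<Gamma> (N z)"
    using weak_solutions_inj[OF assms] by (auto simp: inj_on_def)
  have "\<exists>p\<in>N z. \<Gamma> u = \<Gamma> p" if "u \<in> D" for u
  proof -
    obtain p where "p \<in> N z" "u - p \<in> DD"
      using weak_solution_exists[OF assms \<open>u \<in> D\<close>] by blast
    then show ?thesis
      using that by (intro bexI[of _ p]) (simp_all add: mem_dirichlet mem_weak_solutions trace_diff)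
  qed
  then show "\<Gamma> ` N z = \<Gamma> ` D"
    by (auto simp: image_iff dest: weak_solutions_mem)
qed

lemma
  assumes "dirichlet_regular z"
  shows solution_op_mem: "\<phi> \<in> \<Gamma> ` D \<Longrightarrow> S z \<phi> \<in> N z"
    and trace_solution_op: "\<phi> \<in> \<Gamma> ` D \<Longrightarrow> \<Gamma> (S z \<phi>) = \<phi>"
    and solution_op_trace: "u \<in> N z \<Longrightarrow> S z (\<Gamma> u) = u"
  using bij_betw_trace[OF assms]
  by (auto simp: solution_op_def bij_betw_def the_inv_into_f_f intro: the_inv_into_into f_the_inv_into_f)

lemma solution_op_dom: "dirichlet_regular z \<Longrightarrow> \<phi> \<in> \<Gamma> ` D \<Longrightarrow> S z \<phi> \<in> D"
  using solution_op_mem by (simp add: mem_weak_solutions)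

lemma solution_op_eqI:
  "dirichlet_regular z \<Longrightarrow> u \<in> N z \<Longrightarrow> \<Gamma> u = \<phi> \<Longrightarrow> S z \<phi> = u"
  using solution_op_trace by blast

lemma clinear_on_solution_op:
  assumes "dirichlet_regular z"
  shows "clinear_on (\<Gamma> ` D) (S z)"
  using csubspace_weak_solutions[of z] solution_op_mem[OF assms] solution_op_dom[OF assms]
    trace_solution_op[OF assms]
  unfolding clinear_on_def csubspace_def
  by (intro conjI ballI allI solution_op_eqI[OF assms]) (simp_all add: trace_add trace_scaleC)

lemma solution_proj_eq:
  assumes z: "dirichlet_regular z" and u: "u \<in> D"
  shows "solution_proj D h \<Gamma> z u = S z (\<Gamma> u)"
  unfolding solution_proj_def
proof (rule the_equality)
  show "S z (\<Gamma> u) \<in> N z \<and> u - S z (\<Gamma> u) \<in> DD"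
    using u solution_op_mem[OF z, of "\<Gamma> u"] solution_op_dom[OF z, of "\<Gamma> u"] trace_solution_op[OF z, of "\<Gamma> u"]
    by (simp add: mem_dirichlet trace_diff)
  fix p assume "p \<in> N z \<and> u - p \<in> DD"
  then show "p = S z (\<Gamma> u)"
    using u by (intro solution_op_eqI[OF z, symmetric])
      (auto simp: mem_dirichlet trace_diff dest: weak_solutions_mem)
qed

text \<open>The correction lies in \<open>DD\<close>, so it keeps the trace, and it cancels the term
  by which \<open>S w \<phi>\<close> fails the equation at \<open>z\<close>. With
  \<open>w = -1\<close> it carries bounds over to \<open>S z\<close>.\<close>

lemma solution_op_shift:
  assumes z: "dirichlet_regular z" and w: "dirichlet_regular w" and \<phi>: "\<phi> \<in> \<Gamma> ` D"
  shows "S z \<phi> = S w \<phi> + (z - w) *\<^sub>C RD z (S w \<phi>)"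
proof (rule solution_op_eqI[OF z])
  interpret r: regular_form DD h z
    by (rule dirichlet_regular_form[OF z])
  have R: "RD z f \<in> DD" for f
    using r.R_mem by (simp add: r.R_def)
  have R_eq: "shift_form h z (RD z f) v = cinner f v" if "v \<in> DD" for f v
    using r.shift_form_R[OF that] by (simp add: r.R_def)
  note S = solution_op_mem[OF w \<phi>] solution_op_dom[OF w \<phi>] trace_solution_op[OF w \<phi>]
  show "S w \<phi> + (z - w) *\<^sub>C RD z (S w \<phi>) \<in> N z"
    using S R R_eq by (auto simp: mem_weak_solutions shift.add_left shift.scaleC_left
        shift_form_shift[of z "S w \<phi>" _ w])
  show "\<Gamma> (S w \<phi> + (z - w) *\<^sub>C RD z (S w \<phi>)) = \<phi>"
    using S R[of "S w \<phi>"] by (simp add: trace_add trace_scaleC mem_dirichlet)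
qed

text \<open>\<open>S (-1) (\<Gamma> u)\<close> is the orthogonal projection of \<open>u\<close> in
  the energy inner product. The boundary norm is therefore the least form norm among all elements
  with the given trace.\<close>

lemma form_norm_solution_op_le:
  assumes "u \<in> D"
  shows "form_norm h (S (-1) (\<Gamma> u)) \<le> form_norm h u"
proof -
  note m = dir.minus_one_mem_resolvent_set
  let ?p = "S (-1) (\<Gamma> u)"
  have p: "?p \<in> N (-1)" "?p \<in> D" "\<Gamma> ?p = \<Gamma> u"
    using assms solution_op_mem[OF m] solution_op_dom[OF m] trace_solution_op[OF m] by auto
  then have d: "u - ?p \<in> DD"
    using assms by (simp add: mem_dirichlet trace_diff)
  then have "shift_form h (-1) ?p (u - ?p) = 0"
    using p(1) by (simp only: mem_weak_solutions)
  then have "(form_norm h ?p)\<^sup>2 = cmod (shift_form h (-1) ?p u)"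
    using p assms by (simp add: shift.diff_right shift_form_diag norm_power)
  also have "\<dots> \<le> form_norm h ?p * form_norm h u"
    using p assms by (intro energy_le) auto
  finally show ?thesis
    using p assms by (cases "form_norm h ?p = 0") (auto simp: power2_eq_square less_le)
qed

lemma bd_norm_nonneg: "\<phi> \<in> \<Gamma> ` D \<Longrightarrow> 0 \<le> bd_norm D h \<Gamma> \<phi>"
  using solution_op_dom[OF dir.minus_one_mem_resolvent_set] by (simp add: bd_norm_def)

text \<open>By \<open>form_norm_solution_op_le\<close> the trace is a contraction for the boundary
  norm, so a boundary functional pulls back to a right-hand side of the Neumann problem.\<close>

lemma dual_trace:
  assumes "F \<in> antidual (\<Gamma> ` D) (bd_norm D h \<Gamma>)"
  shows "(\<lambda>v\<in>D. F (\<Gamma> v)) \<in> antidual D (form_norm h)"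
proof -
  obtain C where C: "0 \<le> C" "\<And>\<phi>. \<phi> \<in> \<Gamma> ` D \<Longrightarrow> cmod (F \<phi>) \<le> C * bd_norm D h \<Gamma> \<phi>"
    using antidual_bound[OF assms bd_norm_nonneg] by blast
  have "cmod (F (\<Gamma> v)) \<le> C * form_norm h v" if "v \<in> D" for v
    using C(2)[of "\<Gamma> v"] mult_left_mono[OF form_norm_solution_op_le[OF that] C(1)] that
    by (simp add: bd_norm_def)
  then show ?thesis
    using antidualD(1,2)[OF assms] by (auto simp: antidual_def trace_add trace_scaleC)
qed

text \<open>\<open>S (-1)\<close> is isometric for \<open>bd_norm\<close>, and the resolvent term in
  \<open>solution_op_shift\<close> is bounded into the form domain; so \<open>S z\<close> is bounded
  and its dual is well defined.\<close>

lemma dual_solution_op: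
  assumes z: "dirichlet_regular z" and F: "F \<in> antidual D (form_norm h)"
  shows "dual_map (\<Gamma> ` D) (S z) F \<in> antidual (\<Gamma> ` D) (bd_norm D h \<Gamma>)"
proof -
  interpret r: regular_form DD h z
    by (rule dirichlet_regular_form[OF z])
  note m = dir.minus_one_mem_resolvent_set
  obtain C where C: "0 \<le> C" "\<And>u. u \<in> D \<Longrightarrow> cmod (F u) \<le> C * form_norm h u"
    using antidual_bound[OF F] by (metis form_norm_nonneg)
  obtain K where K: "0 \<le> K" "\<And>f. form_norm h (r.R f) \<le> K * norm f"
    using r.R_form_norm_bounded by blast
  have S_mem: "S z \<phi> \<in> D" if "\<phi> \<in> \<Gamma> ` D" for \<phi>
    by (rule solution_op_dom[OF z that])
  have "cmod (F (S z \<phi>)) \<le> (C + cmod (z + 1) * (C * K)) * bd_norm D h \<Gamma> \<phi>" if \<phi>: "\<phi> \<in> \<Gamma> ` D" for \<phi>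
  proof -
    let ?s = "S (-1) \<phi>"
    have s: "?s \<in> D"
      by (rule solution_op_dom[OF m \<phi>])
    have "F (S z \<phi>) = F ?s + cnj (z + 1) * F (r.R ?s)"
      using solution_op_shift[OF z m \<phi>] s r.R_mem[of ?s] antidualD(1,2)[OF F] by (simp add: r.R_def)
    then have "cmod (F (S z \<phi>)) \<le> cmod (F ?s) + cmod (z + 1) * cmod (F (r.R ?s))"
      by (metis complex_mod_cnj norm_mult norm_triangle_ineq)
    also have "\<dots> \<le> C * form_norm h ?s + cmod (z + 1) * (C * (K * form_norm h ?s))"
    proof (intro add_mono mult_left_mono)
      have "cmod (F (r.R ?s)) \<le> C * form_norm h (r.R ?s)"
        using C(2) by simp
      also have "\<dots> \<le> C * (K * form_norm h ?s)"
        by (rule mult_left_mono[OF order_trans[OF K(2) mult_left_mono[OF norm_le_form_norm[OF s] K(1)]] C(1)])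
      finally show "cmod (F (r.R ?s)) \<le> C * (K * form_norm h ?s)" .
    qed (use C s in auto)
    finally show ?thesis
      by (simp add: bd_norm_def algebra_simps)
  qed
  moreover have "\<phi> \<in> \<Gamma> ` D \<Longrightarrow> \<psi> \<in> \<Gamma> ` D \<Longrightarrow> \<phi> + \<psi> \<in> \<Gamma> ` D" "\<phi> \<in> \<Gamma> ` D \<Longrightarrow> c *\<^sub>C \<phi> \<in> \<Gamma> ` D" for \<phi> \<psi> c
    using csubspace_trace unfolding csubspace_def by blast+
  moreover note clinear_on_solution_op[OF z, unfolded clinear_on_def]
  ultimately show ?thesis
    unfolding antidual_def dual_map_def
    using S_mem antidualD(1,2)[OF F] by (intro CollectI conjI) (auto simp del: image_iff imageE)
qed

text \<open>Since \<open>\<phi>\<close> is the trace of \<open>S (-1) \<phi>\<close>, the bound on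
  \<open>\<Gamma>\<close> controls its norm by the boundary norm.\<close>

lemma to_dual_trace_antidual: "to_dual (\<Gamma> ` D) g \<in> antidual (\<Gamma> ` D) (bd_norm D h \<Gamma>)"
proof -
  note m = dir.minus_one_mem_resolvent_set
  obtain C where C: "\<And>u. u \<in> D \<Longrightarrow> norm (\<Gamma> u) \<le> C * form_norm h u"
    using trace_bounded by blast
  have "cmod (cinner g \<phi>) \<le> norm g * C * bd_norm D h \<Gamma> \<phi>" if \<phi>: "\<phi> \<in> \<Gamma> ` D" for \<phi>
  proof -
    have "norm \<phi> \<le> C * bd_norm D h \<Gamma> \<phi>"
      using C[of "S (-1) \<phi>"] solution_op_dom[OF m \<phi>] trace_solution_op[OF m \<phi>] by (simp add: bd_norm_def)
    from mult_left_mono[OF this norm_ge_zero[of g]] norm_cinner_le[of g \<phi>] show ?thesis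
      by (simp add: mult.assoc)
  qed
  moreover have "\<phi> \<in> \<Gamma> ` D \<Longrightarrow> \<psi> \<in> \<Gamma> ` D \<Longrightarrow> \<phi> + \<psi> \<in> \<Gamma> ` D" "\<phi> \<in> \<Gamma> ` D \<Longrightarrow> c *\<^sub>C \<phi> \<in> \<Gamma> ` D" for \<phi> \<psi> c
    using csubspace_trace unfolding csubspace_def by blast+
  ultimately show ?thesis
    unfolding to_dual_def antidual_def
    by (intro CollectI conjI) (auto simp: cinner_add_right cinner_scaleC_right simp del: image_iff imageE)
qed

text \<open>The second argument of the form may be any element with the given trace, not only the
  solution at \<open>-1\<close>.\<close>

lemma DN_form_trace:
  assumes z: "dirichlet_regular z" and \<phi>: "\<phi> \<in> \<Gamma> ` D" and v: "v \<in> D"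
  shows "DN_form D h \<Gamma> z \<phi> (\<Gamma> v) = shift_form h z (S z \<phi>) v"
proof -
  note m = dir.minus_one_mem_resolvent_set
  let ?s = "S (-1) (\<Gamma> v)"
  have s: "?s \<in> D" "\<Gamma> ?s = \<Gamma> v"
    using v solution_op_dom[OF m] trace_solution_op[OF m] by auto
  then have "v - ?s \<in> DD"
    using v by (simp add: mem_dirichlet trace_diff)
  moreover have S: "S z \<phi> \<in> N z" "S z \<phi> \<in> D"
    by (rule solution_op_mem[OF z \<phi>] solution_op_dom[OF z \<phi>])+
  ultimately have "shift_form h z (S z \<phi>) (v - ?s) = 0"
    by (simp only: mem_weak_solutions)
  then show ?thesis
    using S s v by (simp add: shift.diff_right DN_form_def flip: shift_form_def)
qed

end
section \<open>Krein's resolvent formula\<close>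

locale krein = boundary D h \<Gamma> + neu: regular_form D h z
  for D :: "'h::chilbert_space set" and h :: "'h \<Rightarrow> 'h \<Rightarrow> complex"
    and \<Gamma> :: "'h \<Rightarrow> 'g::chilbert_space" and z :: complex +
  assumes dirichlet_regular: "dirichlet_regular z"
begin

sublocale dir: regular_form DD h z
  by (rule dirichlet_regular_form[OF dirichlet_regular])

lemma dirichlet_regular_cnj: "dirichlet_regular (cnj z)"
  by (rule dir.cnj_mem_resolvent_set)

text \<open>Solve the Neumann problem with \<open>F\<close> composed with \<open>\<Gamma>\<close>.
  This functional vanishes on Dirichlet elements, so the solution lies in \<open>N z\<close> and its
  trace is the preimage.\<close>

lemma weak_DN_ex:
  assumes F: "F \<in> antidual (\<Gamma> ` D) (bd_norm D h \<Gamma>)"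
  shows "\<exists>\<phi>\<in>\<Gamma> ` D. weak_DN D h \<Gamma> z \<phi> = F"
proof -
  obtain u where u: "u \<in> D" "\<And>v. v \<in> D \<Longrightarrow> shift_form h z u v = F (\<Gamma> v)"
    using neu.weak_solvable[OF dual_trace[OF F]] by auto
  have "F 0 = 0"
    using antidualD(2)[OF F, of "\<Gamma> 0" 0] form.zero_mem trace_zero
    by (metis imageI complex_cnj_zero mult_zero_left scaleC_zero_left)
  then have "u \<in> N z"
    using u by (simp add: mem_weak_solutions mem_dirichlet)
  then have Su: "S z (\<Gamma> u) = u"
    by (rule solution_op_trace[OF dirichlet_regular])
  have "weak_DN D h \<Gamma> z (\<Gamma> u) = F"
  proof (rule extensionalityI)
    show "weak_DN D h \<Gamma> z (\<Gamma> u) \<in> extensional (\<Gamma> ` D)"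
      by (simp add: weak_DN_def)
    show "F \<in> extensional (\<Gamma> ` D)"
      by (rule antidualD(4)[OF F])
    fix \<psi> assume "\<psi> \<in> \<Gamma> ` D"
    then obtain v where v: "v \<in> D" "\<psi> = \<Gamma> v"
      by blast
    then show "weak_DN D h \<Gamma> z (\<Gamma> u) \<psi> = F \<psi>"
      using DN_form_trace[OF dirichlet_regular, of "\<Gamma> u" v] u Su by (simp add: weak_DN_def)
  qed
  then show ?thesis
    using u by blast
qed

text \<open>By \<open>DN_form_trace\<close>, equal images make \<open>S z \<phi>\<close> and
  \<open>S z \<psi>\<close> solve the same Neumann equation, which has at most one solution at a
  regular \<open>z\<close>.\<close>

lemma inj_on_weak_DN: "inj_on (weak_DN D h \<Gamma> z) (\<Gamma> ` D)"
proof (rule inj_onI)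
  fix \<phi> \<psi> assume \<phi>: "\<phi> \<in> \<Gamma> ` D" and \<psi>: "\<psi> \<in> \<Gamma> ` D" and eq: "weak_DN D h \<Gamma> z \<phi> = weak_DN D h \<Gamma> z \<psi>"
  have "S z \<phi> = S z \<psi>"
  proof (rule neu.shift_form_inj)
    fix v assume v: "v \<in> D"
    from fun_cong[OF eq, of "\<Gamma> v"] v have "DN_form D h \<Gamma> z \<phi> (\<Gamma> v) = DN_form D h \<Gamma> z \<psi> (\<Gamma> v)"
      by (simp add: weak_DN_def)
    then show "shift_form h z (S z \<phi>) v = shift_form h z (S z \<psi>) v"
      using \<phi> \<psi> v by (simp add: DN_form_trace[OF dirichlet_regular])
  qed (use \<phi> \<psi> in \<open>auto intro: solution_op_dom[OF dirichlet_regular]\<close>)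
  then show "\<phi> = \<psi>"
    using trace_solution_op[OF dirichlet_regular] \<phi> \<psi> by metis
qed

lemma weak_DN_inv_eqI: "\<phi> \<in> \<Gamma> ` D \<Longrightarrow> weak_DN D h \<Gamma> z \<phi> = F \<Longrightarrow> weak_DN_inv D h \<Gamma> z F = \<phi>"
  unfolding weak_DN_inv_def using the_inv_into_f_f[OF inj_on_weak_DN] by blast

lemma weak_DN_inv_mem: "F \<in> antidual (\<Gamma> ` D) (bd_norm D h \<Gamma>) \<Longrightarrow> weak_DN_inv D h \<Gamma> z F \<in> \<Gamma> ` D"
  using weak_DN_ex weak_DN_inv_eqI by metis

section \<open>Weak Krein identities\<close>

lemma dual_inclusion:
  assumes "F \<in> antidual D (form_norm h)"
  shows "dual_map DD (\<lambda>u. u) F \<in> antidual DD (form_norm h)"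
  unfolding dual_map_def by (rule antidual_restrict[OF assms csubspace_dirichlet]) auto

context
  fixes F
  assumes F: "F \<in> antidual D (form_norm h)"
begin

lemma weak_krein_proj:
  "weak_resolvent D h z F - weak_resolvent DD h z (dual_map DD (\<lambda>u. u) F)
    = solution_proj D h \<Gamma> z (weak_resolvent D h z F)"
proof -
  let ?u = "weak_resolvent D h z F" and ?d = "weak_resolvent DD h z (dual_map DD (\<lambda>u. u) F)"
  note u = neu.weak_resolvent[OF F] and d = dir.weak_resolvent[OF dual_inclusion[OF F]]
  have "?u - ?d \<in> N z"
    using u d by (simp add: mem_weak_solutions shift.diff_left dual_map_def)
  moreover have "\<Gamma> (?u - ?d) = \<Gamma> ?u"
    using u(1) d(1) by (simp add: trace_diff mem_dirichlet)
  ultimately show ?thesis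
    using solution_op_eqI[OF dirichlet_regular] u(1)
    by (simp add: solution_proj_eq[OF dirichlet_regular])
qed

text \<open>Testing with \<open>v = S (cnj z) \<psi>\<close> removes the Dirichlet part, as \<open>v\<close> is a weak solution
  for \<open>cnj z\<close>.\<close>

lemma weak_krein_DN:
  "solution_proj D h \<Gamma> z (weak_resolvent D h z F)
    = S z (weak_DN_inv D h \<Gamma> z (dual_map (\<Gamma> ` D) (S (cnj z)) F))"
proof -
  let ?u = "weak_resolvent D h z F" and ?d = "weak_resolvent DD h z (dual_map DD (\<lambda>u. u) F)"
  note u = neu.weak_resolvent[OF F] and d = dir.weak_resolvent[OF dual_inclusion[OF F]]
  have Su: "S z (\<Gamma> ?u) = ?u - ?d"
    using weak_krein_proj u(1) by (simp add: solution_proj_eq[OF dirichlet_regular])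
  have "weak_DN_inv D h \<Gamma> z (dual_map (\<Gamma> ` D) (S (cnj z)) F) = \<Gamma> ?u"
  proof (rule weak_DN_inv_eqI)
    show "weak_DN D h \<Gamma> z (\<Gamma> ?u) = dual_map (\<Gamma> ` D) (S (cnj z)) F"
      unfolding weak_DN_def dual_map_def
    proof (rule restrict_ext)
      fix \<psi> assume \<psi>: "\<psi> \<in> \<Gamma> ` D"
      let ?v = "S (cnj z) \<psi>"
      have v: "?v \<in> D" "?v \<in> N (cnj z)" "\<Gamma> ?v = \<psi>"
        using solution_op_dom solution_op_mem trace_solution_op dirichlet_regular_cnj \<psi> by auto
      have "DN_form D h \<Gamma> z (\<Gamma> ?u) \<psi> = shift_form h z (?u - ?d) ?v"
        using DN_form_trace[OF dirichlet_regular, of "\<Gamma> ?u" ?v] u v Su by simp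
      also have "\<dots> = F ?v - cnj (shift_form h (cnj z) ?v ?d)"
        using u d v shift_form_commute[of ?d ?v z] by (simp add: shift.diff_left)
      also have "\<dots> = F ?v"
        using v d by (simp add: mem_weak_solutions)
      finally show "DN_form D h \<Gamma> z (\<Gamma> ?u) \<psi> = F ?v" .
    qed
  qed (use u in simp)
  then show ?thesis
    using u(1) by (simp add: solution_proj_eq[OF dirichlet_regular])
qed

end

text \<open>The strong resolvents solve the weak equations whose right-hand side is the functional
  of \<open>f\<close>, and weak solutions are unique. The strong identity becomes a special case of
  the weak one.\<close>

lemma resolvent_eq_weak_resolvent:
  "resolvent (form_op D h) z f = weak_resolvent D h z (to_dual D f)"
  "resolvent (form_op DD h) z f = weak_resolvent DD h z (dual_map DD (\<lambda>u. u) (to_dual D f))"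
proof -
  have "weak_resolvent D h z (to_dual D f) = neu.R f"
    by (rule neu.weak_resolvent_eqI[OF to_dual_antidual]) (simp_all add: neu.shift_form_R to_dual_def)
  then show "resolvent (form_op D h) z f = weak_resolvent D h z (to_dual D f)"
    by (simp add: neu.R_def)
  have "weak_resolvent DD h z (dual_map DD (\<lambda>u. u) (to_dual D f)) = dir.R f"
    by (rule dir.weak_resolvent_eqI[OF dual_inclusion[OF to_dual_antidual]])
      (simp_all add: dir.shift_form_R to_dual_def dual_map_def)
  then show "resolvent (form_op DD h) z f = weak_resolvent DD h z (dual_map DD (\<lambda>u. u) (to_dual D f))"
    by (simp add: dir.R_def)
qed

lemma krein:
  "resolvent (form_op D h) z f - resolvent (form_op DD h) z f
    = S z (weak_DN_inv D h \<Gamma> z (dual_map (\<Gamma> ` D) (S (cnj z)) (to_dual D f)))"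
  unfolding resolvent_eq_weak_resolvent
  using weak_krein_proj weak_krein_DN to_dual_antidual by simp

text \<open>Every \<open>g\<close> defines a boundary functional, on which the weak operator is
  invertible; the strong inverse is the restriction of the weak one.\<close>

lemma strong_DN_iff:
  "(\<phi>, g) \<in> strong_DN D h \<Gamma> z \<longleftrightarrow> \<phi> = weak_DN_inv D h \<Gamma> z (to_dual (\<Gamma> ` D) g)"
  using weak_DN_ex[OF to_dual_trace_antidual, of g] weak_DN_inv_eqI[of _ "to_dual (\<Gamma> ` D) g"]
  unfolding strong_DN_def mem_Collect_eq prod.case by metis

lemma op_inv_strong_DN: "op_inv (strong_DN D h \<Gamma> z) g = weak_DN_inv D h \<Gamma> z (to_dual (\<Gamma> ` D) g)"
  by (simp add: op_inv_def strong_DN_iff)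

end

section \<open>The elliptically regular case\<close>

lemma (in boundary) solution_op_ext:
  assumes ell: "elliptically_regular D h \<Gamma>" and z: "dirichlet_regular z"
  shows "bounded_clinear (solution_op_ext D h \<Gamma> z)"
    and "\<phi> \<in> \<Gamma> ` D \<Longrightarrow> solution_op_ext D h \<Gamma> z \<phi> = S z \<phi>"
proof -
  interpret r: regular_form DD h z
    by (rule dirichlet_regular_form[OF z])
  obtain C where C: "0 < C" "\<And>\<phi>. \<phi> \<in> \<Gamma> ` D \<Longrightarrow> norm (S (-1) \<phi>) \<le> C * norm \<phi>"
    using ell by (auto simp: elliptically_regular_def)
  obtain K where K: "0 \<le> K" "\<And>f. norm (r.R f) \<le> K * norm f"
    using r.R_bounded by blast
  \<comment> \<open>Regularity bounds \<open>S (-1)\<close> only; \<open>solution_op_shift\<close>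
    and the Hilbert space bound of the Dirichlet resolvent transfer the estimate to
    \<open>z\<close>.\<close>
  have "norm (S z \<phi>) \<le> (C + cmod (z + 1) * K * C) * norm \<phi>" if \<phi>: "\<phi> \<in> \<Gamma> ` D" for \<phi>
  proof -
    have "S z \<phi> = S (-1) \<phi> + (z + 1) *\<^sub>C r.R (S (-1) \<phi>)"
      using solution_op_shift[OF z dir.minus_one_mem_resolvent_set \<phi>] by (simp add: r.R_def)
    then have "norm (S z \<phi>) \<le> norm (S (-1) \<phi>) + cmod (z + 1) * norm (r.R (S (-1) \<phi>))"
      by (metis norm_scaleC norm_triangle_ineq)
    also have "\<dots> \<le> C * norm \<phi> + cmod (z + 1) * (K * (C * norm \<phi>))"
      by (intro add_mono C(2)[OF \<phi>] mult_left_mono order_trans[OF K(2)] K(1)) simp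
    finally show ?thesis
      by (simp add: algebra_simps)
  qed
  from theI'[OF dense_extension_ex1[OF csubspace_trace trace_dense clinear_on_solution_op[OF z] this]]
  show "bounded_clinear (solution_op_ext D h \<Gamma> z)"
    and "\<phi> \<in> \<Gamma> ` D \<Longrightarrow> solution_op_ext D h \<Gamma> z \<phi> = S z \<phi>"
    unfolding solution_op_ext_def by blast+
qed

text \<open>On traces the extension agrees with \<open>S (cnj z)\<close>, so its adjoint maps
  \<open>f\<close> to an element of the boundary space representing the dual of
  \<open>S (cnj z)\<close> at \<open>f\<close>. The weak identity then only involves the strong
  inverse.\<close>

lemma (in krein) strong_krein:
  assumes ell: "elliptically_regular D h \<Gamma>"
  shows "resolvent (form_op D h) z f - resolvent (form_op DD h) z f
    = solution_op_ext D h \<Gamma> z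
        (op_inv (strong_DN D h \<Gamma> z) (cadjoint (solution_op_ext D h \<Gamma> (cnj z)) f))"
proof -
  note ext = solution_op_ext[OF ell dirichlet_regular]
    and ext_cnj = solution_op_ext[OF ell dirichlet_regular_cnj]
  let ?g = "cadjoint (solution_op_ext D h \<Gamma> (cnj z)) f"
  have "cinner ?g \<psi> = cinner f (S (cnj z) \<psi>)" if "\<psi> \<in> \<Gamma> ` D" for \<psi>
    using cadjoint[OF ext_cnj(1), of \<psi> f] ext_cnj(2)[OF that] by (metis cinner_commute)
  then have "to_dual (\<Gamma> ` D) ?g = dual_map (\<Gamma> ` D) (S (cnj z)) (to_dual D f)"
    using solution_op_dom[OF dirichlet_regular_cnj]
    unfolding to_dual_def dual_map_def by (intro restrict_ext) simp
  then show ?thesis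
    \<comment> \<open>The inverse takes values in the trace space, where the extension may be
      replaced by \<open>S z\<close>.\<close>
    using ext(2)[OF weak_DN_inv_mem[OF to_dual_trace_antidual[of ?g]]]
    by (simp add: krein op_inv_strong_DN)
qed

text \<open>The leading membership claims record that the three factors map between the intended
  spaces, and the unique existence clause makes \<open>op_inv\<close> a genuine inverse on the whole
  boundary space.\<close>

theorem theorem4p3:
  fixes D :: "'h::chilbert_space set"
    and h :: "'h \<Rightarrow> 'h \<Rightarrow> complex"
    and \<Gamma> :: "'h \<Rightarrow> 'g::chilbert_space"
    and z :: complex
  assumes form: "closed_nonneg_form D h"
    and bp: "boundary_pair D h \<Gamma>"
    and z: "z \<notin> spectrum (form_op (dirichlet_dom D \<Gamma>) h) \<union> spectrum (form_op D h)"
  shows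
    "dual_map (\<Gamma> ` D) (solution_op D h \<Gamma> (cnj z))
        \<in> antidual D (form_norm h) \<rightarrow> antidual (\<Gamma> ` D) (bd_norm D h \<Gamma>) \<and>
     weak_DN_inv D h \<Gamma> z \<in> antidual (\<Gamma> ` D) (bd_norm D h \<Gamma>) \<rightarrow> \<Gamma> ` D \<and>
     solution_op D h \<Gamma> z \<in> \<Gamma> ` D \<rightarrow> D \<and>
     (\<forall>F \<in> antidual D (form_norm h).
        weak_resolvent D h z F
          - weak_resolvent (dirichlet_dom D \<Gamma>) h z (dual_map (dirichlet_dom D \<Gamma>) (\<lambda>u. u) F)
          = solution_proj D h \<Gamma> z (weak_resolvent D h z F) \<and>
        solution_proj D h \<Gamma> z (weak_resolvent D h z F)
          = solution_op D h \<Gamma> z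
              (weak_DN_inv D h \<Gamma> z (dual_map (\<Gamma> ` D) (solution_op D h \<Gamma> (cnj z)) F))) \<and>
     (\<forall>f. resolvent (form_op D h) z f - resolvent (form_op (dirichlet_dom D \<Gamma>) h) z f
          = solution_op D h \<Gamma> z
              (weak_DN_inv D h \<Gamma> z
                (dual_map (\<Gamma> ` D) (solution_op D h \<Gamma> (cnj z)) (to_dual D f)))) \<and>
     (elliptically_regular D h \<Gamma> \<longrightarrow>
        (\<forall>g. \<exists>!\<phi>. (\<phi>, g) \<in> strong_DN D h \<Gamma> z) \<and>
        (\<forall>f. resolvent (form_op D h) z f - resolvent (form_op (dirichlet_dom D \<Gamma>) h) z f
          = solution_op_ext D h \<Gamma> z
              (op_inv (strong_DN D h \<Gamma> z)
                (cadjoint (solution_op_ext D h \<Gamma> (cnj z)) f))))"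
proof -
  interpret boundary D h \<Gamma>
    using form bp by unfold_locales
  interpret krein D h \<Gamma> z
    using z by unfold_locales (simp_all add: spectrum_def)
  have S_mem: "\<phi> \<in> \<Gamma> ` D \<Longrightarrow> S z \<phi> \<in> D" for \<phi>
    by (rule solution_op_dom[OF dirichlet_regular])
  show ?thesis
    using dual_solution_op[OF dirichlet_regular_cnj] weak_DN_inv_mem S_mem weak_krein_proj weak_krein_DN
      krein strong_DN_iff strong_krein
    by (intro conjI ballI allI impI funcsetI) simp_all
qed

end
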